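(* Let $m\ge2$ and $q\ge2$ be integers and let $T=(t_0<\cdots<t_{m-1})$ be an ordered real $m$-alphabet. Let $V\subseteq\mathbb{Q}^{m-1}$ be the rational span of the deleted rows of all $q$-relations vanishing on $T$, let $r=\dim V$ and $d=m-1-r$. Choose a basis of $V$ consisting of deleted rows of $q$-relations vanishing on $T$, whose full balanced vectors have masses $h_1,\dots,h_r$ (each at most $q$), and put $H=\prod_{i=1}^r h_i$ (with $H=1$ if $r=0$). Then $T$ has a primitive order-preserving integer $q$-model of diameter at most \[ H\sum_{j=0}^{d-1}q^j . \]
   Context: A balanced vector is $\delta=(\delta_0,\dots,\delta_{m-1})\in\mathbb{Z}^m$ with $\sum_i\delta_i=0$; its mass is $\sum_i\max(\delta_i,0)$. A $q$-relation is a balanced vector of mass at most $q$; it vanishes on $T=(t_0<\cdots<t_{m-1})$ if $\delta\cdot T:=\sum_i\delta_it_i=0$. The deleted row of $\delta$ is $(\delta_1,\dots,\delta_{m-1})$ (coordinate zero removed); it determines $\delta$. An order-preserving integer $q$-model of $T$ is a strictly increasing integer tuple $T'=(t'_0<\cdots<t'_{m-1})$ such that for every balanced $\delta$ of mass at most $q$, $\delta\cdot T=0$ if and only if $\delta\cdot T'=0$. Its diameter is $t'_{m-1}-t'_0$; it is primitive if, after translating its first letter to $0$, the gcd of its letters is $1$. *)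

theory Defs
  imports Complex_Main "Jordan_Normal_Form.VS_Connect"
begin

text \<open>Tuples indexed by \<open>0, \<dots>, m - 1\<close> are vectors of dimension \<open>m\<close>.\<close>

definition increasing_tuple :: "nat \<Rightarrow> 'a::linorder vec \<Rightarrow> bool" where
  "increasing_tuple m T \<longleftrightarrow>
     T \<in> carrier_vec m \<and> (\<forall>i j. i < j \<and> j < m \<longrightarrow> T $ i < T $ j)"

definition balanced :: "nat \<Rightarrow> int vec \<Rightarrow> bool" where
  "balanced m \<delta> \<longleftrightarrow> \<delta> \<in> carrier_vec m \<and> (\<Sum>i<m. \<delta> $ i) = 0"

definition mass :: "int vec \<Rightarrow> int" where
  "mass \<delta> = (\<Sum>i<dim_vec \<delta>. max (\<delta> $ i) 0)"

definition q_relation :: "nat \<Rightarrow> nat \<Rightarrow> int vec \<Rightarrow> bool" where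
  "q_relation m q \<delta> \<longleftrightarrow> balanced m \<delta> \<and> mass \<delta> \<le> int q"

definition vanishes_on :: "int vec \<Rightarrow> 'a::comm_ring_1 vec \<Rightarrow> bool" where
  "vanishes_on \<delta> T \<longleftrightarrow> map_vec of_int \<delta> \<bullet> T = 0"

definition deleted_row :: "int vec \<Rightarrow> rat vec" where
  "deleted_row \<delta> = vec (dim_vec \<delta> - 1) (\<lambda>i. of_int (\<delta> $ Suc i))"

text \<open>The rational span of the deleted rows, as a vector space in its own right (a subspace of
  the space of rational vectors of dimension \<open>m - 1\<close>), so that its dimension and its bases
  are those of the library.\<close>

definition relation_space :: "nat \<Rightarrow> nat \<Rightarrow> real vec \<Rightarrow> (rat, rat vec) module" where
  "relation_space m q T =
     (module_vec TYPE(rat) (m - 1))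
       \<lparr>carrier := LinearCombinations.module.span class_ring (module_vec TYPE(rat) (m - 1))
          (deleted_row ` {\<delta>. q_relation m q \<delta> \<and> vanishes_on \<delta> T})\<rparr>"

definition integer_q_model :: "nat \<Rightarrow> nat \<Rightarrow> real vec \<Rightarrow> int vec \<Rightarrow> bool" where
  "integer_q_model m q T T' \<longleftrightarrow>
     increasing_tuple m T' \<and>
     (\<forall>\<delta>. q_relation m q \<delta> \<longrightarrow> (vanishes_on \<delta> T \<longleftrightarrow> vanishes_on \<delta> T'))"

definition diameter :: "int vec \<Rightarrow> int" where
  "diameter T' = T' $ (dim_vec T' - 1) - T' $ 0"

definition primitive :: "int vec \<Rightarrow> bool" where
  "primitive T' \<longleftrightarrow> Gcd ((\<lambda>i. T' $ i - T' $ 0) ` {..<dim_vec T'}) = 1"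

end

theory Submission
  imports Defs
begin

text \<open>
  Translate the first letter to \<open>0\<close> and consider the cone of weakly increasing tuples annihilated
  by the relations in the basis; it has dimension \<open>d\<close>. A ray of it that is cut out by the basis and
  \<open>d - 1\<close> further balanced vectors has an integer generator given by minors of a matrix with one
  balanced vector per row, and such a determinant is at most the product of the masses.
  Setting one gap to \<open>0\<close> gives a facet of the cone, cut out by an additional relation of mass \<open>1\<close>.
  By induction the facet contains an integer point \<open>y\<close> that lies on no \<open>q\<close>-relation hyperplane except those
  containing the facet. The chamber of the \<open>q\<close>-relation arrangement next to \<open>y\<close> has an extreme ray
  \<open>x\<close> off the facet, of diameter at most \<open>H * q ^ (d - 1)\<close>, and \<open>y + x\<close> lies in the open chamber.
  Along a flag of faces this adds up to \<open>H * (\<Sum>j<d. q ^ j)\<close>.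
\<close>

subsection \<open>Determinants with rows of bounded mass\<close>

text \<open>Bound \<open>C j\<close> by \<open>M\<close> under a positive weight and by
  \<open>N\<close> under a negative one. Including \<open>0\<close> among the values gives
  \<open>N \<le> 0 \<le> M\<close>, so both weight totals may be replaced by \<open>h\<close>; the
  bound involves only \<open>M - N\<close>.\<close>

lemma sum_mult_le_oscillation:
  fixes a C :: "nat \<Rightarrow> 'a::linordered_idom"
  assumes pos: "(\<Sum>j<n. max (a j) 0) \<le> h" and neg: "(\<Sum>j<n. max (- a j) 0) \<le> h"
    and C: "\<And>j. j < n \<Longrightarrow> \<bar>C j\<bar> \<le> B"
    and CC: "\<And>j k. j < n \<Longrightarrow> k < n \<Longrightarrow> \<bar>C j - C k\<bar> \<le> B"
    and B: "0 \<le> B"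
  shows "(\<Sum>j<n. a j * C j) \<le> h * B"
proof -
  define M where "M = Max (insert 0 (C ` {..<n}))"
  define N where "N = Min (insert 0 (C ` {..<n}))"
  have M: "C j \<le> M" "N \<le> C j" if "j < n" for j
    using that by (auto simp: M_def N_def)
  have M0: "0 \<le> M" "N \<le> 0" by (auto simp: M_def N_def)
  have "M \<in> insert 0 (C ` {..<n})" "N \<in> insert 0 (C ` {..<n})"
    unfolding M_def N_def by (rule Max_in Min_in; simp)+
  then have MN: "M - N \<le> B"
    using C CC B by (auto simp: abs_le_iff)
  have h: "0 \<le> h"
    using pos by (rule order_trans[rotated]) (simp add: sum_nonneg)
  have "(\<Sum>j<n. a j * C j) \<le> (\<Sum>j<n. max (a j) 0 * M - max (- a j) 0 * N)"
  proof (rule sum_mono)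
    fix j assume "j \<in> {..<n}"
    then have "max (a j) 0 * C j \<le> max (a j) 0 * M" "max (- a j) 0 * N \<le> max (- a j) 0 * C j"
      using M by (auto intro!: mult_left_mono)
    moreover have "a j * C j = max (a j) 0 * C j - max (- a j) 0 * C j"
      by (auto simp: max_def)
    ultimately show "a j * C j \<le> max (a j) 0 * M - max (- a j) 0 * N" by linarith
  qed
  also have "\<dots> = (\<Sum>j<n. max (a j) 0) * M + (\<Sum>j<n. max (- a j) 0) * (- N)"
    by (simp add: sum_subtractf sum_distrib_right)
  also have "\<dots> \<le> h * M + h * (- N)"
    using M0 pos neg by (intro add_mono mult_right_mono) auto
  also have "\<dots> = h * (M - N)" by (simp add: algebra_simps)
  also have "\<dots> \<le> h * B" using MN h by (rule mult_left_mono)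
  finally show ?thesis .
qed

lemma abs_sum_mult_le_oscillation:
  fixes a C :: "nat \<Rightarrow> 'a::linordered_idom"
  assumes "(\<Sum>j<n. max (a j) 0) \<le> h" and "(\<Sum>j<n. max (- a j) 0) \<le> h"
    and "\<And>j. j < n \<Longrightarrow> \<bar>C j\<bar> \<le> B"
    and "\<And>j k. j < n \<Longrightarrow> k < n \<Longrightarrow> \<bar>C j - C k\<bar> \<le> B"
    and "0 \<le> B"
  shows "\<bar>\<Sum>j<n. a j * C j\<bar> \<le> h * B"
  using sum_mult_le_oscillation[of a n h C B] sum_mult_le_oscillation[of "\<lambda>j. - a j" n h C B] assms
  by (simp add: abs_le_iff sum_negf)

text \<open>Induction on \<open>n\<close> by expansion along row \<open>0\<close>. Bounding the
  cofactors alone would cost a factor 2 per row; the oscillation estimate avoids it once their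
  differences obey the same bound \<open>B\<close>. These differences are, up to sign, minors of the
  same kind.\<close>

lemma abs_det_le_prod:
  fixes A :: "'a::linordered_idom mat"
  assumes "A \<in> carrier_mat n n"
    and "\<And>i. i < n \<Longrightarrow> (\<Sum>j<n. max (A $$ (i, j)) 0) \<le> h i"
    and "\<And>i. i < n \<Longrightarrow> (\<Sum>j<n. max (- A $$ (i, j)) 0) \<le> h i"
  shows "\<bar>det A\<bar> \<le> (\<Prod>i<n. h i)"
  using assms
proof (induction n arbitrary: A h)
  case 0
  then show ?case by simp
next
  case (Suc n)
  note A = Suc.prems(1)
  define B where "B = (\<Prod>i<n. h (Suc i))"
  have hnn: "0 \<le> h i" if "i < Suc n" for i
    using Suc.prems(2)[OF that] by (rule order_trans[rotated]) (simp add: sum_nonneg)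
  then have B0: "0 \<le> B" unfolding B_def by (intro prod_nonneg) auto
  \<comment> \<open>Stated for arbitrary \<open>M\<close>, because it serves both \<open>A\<close>
    and a matrix obtained from it by a column operation.\<close>
  have del: "\<bar>det (mat_delete M 0 j)\<bar> \<le> B"
    if M: "M \<in> carrier_mat (Suc n) (Suc n)" and j: "j < Suc n"
      and p: "\<And>i. i < n \<Longrightarrow> (\<Sum>l\<in>{..<Suc n} - {j}. max (M $$ (Suc i, l)) 0) \<le> h (Suc i)"
      and q: "\<And>i. i < n \<Longrightarrow> (\<Sum>l\<in>{..<Suc n} - {j}. max (- M $$ (Suc i, l)) 0) \<le> h (Suc i)"
    for M :: "'a mat" and j
  proof -
    have bij: "bij_betw (insert_index j) {..<n} ({..<Suc n} - {j})"
      using insert_index_inj_on[of j "{..<n}"] insert_index_image[OF j]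
      by (auto simp: bij_betw_def atLeast0LessThan)
    have ent: "mat_delete M 0 j $$ (i, l) = M $$ (Suc i, insert_index j l)" if "i < n" "l < n" for i l
      using M that by (auto simp: mat_delete_def insert_index_def)
    show ?thesis
      unfolding B_def
    proof (rule Suc.IH)
      show "mat_delete M 0 j \<in> carrier_mat n n"
        using mat_delete_carrier[OF M] by simp
    next
      fix i assume i: "i < n"
      have "(\<Sum>l<n. max (mat_delete M 0 j $$ (i, l)) 0) = (\<Sum>l<n. max (M $$ (Suc i, insert_index j l)) 0)"
        using i by (intro sum.cong) (auto simp: ent)
      also have "\<dots> = (\<Sum>l\<in>{..<Suc n} - {j}. max (M $$ (Suc i, l)) 0)"
        by (rule sum.reindex_bij_betw[OF bij])
      finally show "(\<Sum>l<n. max (mat_delete M 0 j $$ (i, l)) 0) \<le> h (Suc i)" using p[OF i] by simp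
      have "(\<Sum>l<n. max (- mat_delete M 0 j $$ (i, l)) 0) = (\<Sum>l<n. max (- M $$ (Suc i, insert_index j l)) 0)"
        using i by (intro sum.cong) (auto simp: ent)
      also have "\<dots> = (\<Sum>l\<in>{..<Suc n} - {j}. max (- M $$ (Suc i, l)) 0)"
        by (rule sum.reindex_bij_betw[OF bij])
      finally show "(\<Sum>l<n. max (- mat_delete M 0 j $$ (i, l)) 0) \<le> h (Suc i)" using q[OF i] by simp
    qed
  qed
  define C where "C j = cofactor A 0 j" for j
  have abs_cof: "\<bar>cofactor M 0 j\<bar> = \<bar>det (mat_delete M 0 j)\<bar>" for M :: "'a mat" and j
    by (simp add: cofactor_def abs_mult)
  have C: "\<bar>C j\<bar> \<le> B" if j: "j < Suc n" for j
    unfolding C_def abs_cof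
  proof (rule del[OF A j])
    fix i assume "i < n"
    then have i: "Suc i < Suc n" by simp
    show "(\<Sum>l\<in>{..<Suc n} - {j}. max (A $$ (Suc i, l)) 0) \<le> h (Suc i)"
      using Suc.prems(2)[OF i] by (rule order_trans[rotated]) (intro sum_mono2; simp)
    show "(\<Sum>l\<in>{..<Suc n} - {j}. max (- A $$ (Suc i, l)) 0) \<le> h (Suc i)"
      using Suc.prems(3)[OF i] by (rule order_trans[rotated]) (intro sum_mono2; simp)
  qed
  have CC: "\<bar>C j - C k\<bar> \<le> B" if j: "j < Suc n" and k: "k < Suc n" for j k
  proof (cases "j = k")
    case True
    with B0 show ?thesis by simp
  next
    case False
    \<comment> \<open>\<open>C j - C k\<close> is the determinant with first row \<open>e\<^sub>j - e\<^sub>k\<close>; adding column \<open>j\<close> to column \<open>k\<close>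
      makes it a minor whose rows still satisfy the mass bounds.\<close>
    define A' where "A' = mat (Suc n) (Suc n) (\<lambda>(i, l). if i = 0 then
        (if l = j then 1 else if l = k then - 1 else 0) else A $$ (i, l))"
    define A'' where "A'' = addcol 1 k j A'"
    have A': "A' \<in> carrier_mat (Suc n) (Suc n)" and A'': "A'' \<in> carrier_mat (Suc n) (Suc n)"
      by (auto simp: A'_def A''_def)
    \<comment> \<open>Cofactors along row \<open>0\<close> do not see row \<open>0\<close>, the only
      row in which \<open>A'\<close> and \<open>A\<close> differ.\<close>
    have cof: "cofactor A' 0 l = C l" for l
      unfolding C_def cofactor_def
      using A by (auto simp: A'_def mat_delete_def intro!: arg_cong[where f = det])
    have row: "A' $$ (0, l) = (if l = j then 1 else if l = k then - 1 else 0)" if "l < Suc n" for l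
      using that by (simp add: A'_def)
    have "det A' = (\<Sum>l<Suc n. A' $$ (0, l) * cofactor A' 0 l)"
      by (rule laplace_expansion_row[OF A']) simp
    also have "\<dots> = (\<Sum>l<Suc n. (if l = j then C l else 0) - (if l = k then C l else 0))"
      using False by (intro sum.cong) (auto simp: row cof)
    also have "\<dots> = C j - C k"
      using j k by (simp add: sum_subtractf del: sum.lessThan_Suc)
    finally have d': "det A' = C j - C k" .
    have "det A'' = det A'"
      unfolding A''_def by (rule det_addcol[OF j _ A']) (use False in simp)
    moreover have "det A'' = (\<Sum>l<Suc n. A'' $$ (0, l) * cofactor A'' 0 l)"
      by (rule laplace_expansion_row[OF A'']) simp
    moreover have "\<dots> = (\<Sum>l<Suc n. if l = j then cofactor A'' 0 l else 0)"
      using False j k A' by (intro sum.cong) (auto simp: row A''_def)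
    moreover have "\<dots> = cofactor A'' 0 j" using j by (simp del: sum.lessThan_Suc)
    ultimately have "C j - C k = cofactor A'' 0 j" using d' by simp
    moreover have "\<bar>det (mat_delete A'' 0 j)\<bar> \<le> B"
    proof (rule del[OF A'' j])
      fix i assume "i < n"
      then have i: "Suc i < Suc n" by simp
      have ent: "A'' $$ (Suc i, l) = A $$ (Suc i, l) + (if l = k then A $$ (Suc i, j) else 0)"
        if "l < Suc n" for l
        using that i j k False by (auto simp: A'_def A''_def)
      \<comment> \<open>Adding one entry to another cannot raise the sum of positive parts, since
        \<open>max (u + v) 0 \<le> max u 0 + max v 0\<close>.\<close>
      have merge: "(\<Sum>l\<in>{..<Suc n} - {j}. max (f l + (if l = k then f j else 0)) 0)
          \<le> (\<Sum>l<Suc n. max (f l) 0)" for f :: "nat \<Rightarrow> 'a"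
      proof -
        have "(\<Sum>l\<in>{..<Suc n} - {j}. max (f l + (if l = k then f j else 0)) 0)
          \<le> (\<Sum>l\<in>{..<Suc n} - {j}. max (f l) 0 + (if l = k then max (f j) 0 else 0))"
          by (intro sum_mono) (auto simp: max_def)
        also have "\<dots> = (\<Sum>l\<in>{..<Suc n} - {j}. max (f l) 0) + max (f j) 0"
          using False k by (simp add: sum.distrib del: sum.lessThan_Suc)
        also have "\<dots> = (\<Sum>l<Suc n. max (f l) 0)"
          using j by (subst sum.remove[of "{..<Suc n}" j]) (auto simp del: sum.lessThan_Suc)
        finally show ?thesis .
      qed
      have "(\<Sum>l\<in>{..<Suc n} - {j}. max (A'' $$ (Suc i, l)) 0)
        = (\<Sum>l\<in>{..<Suc n} - {j}. max (A $$ (Suc i, l) + (if l = k then A $$ (Suc i, j) else 0)) 0)"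
        by (intro sum.cong) (auto simp: ent)
      also have "\<dots> \<le> (\<Sum>l<Suc n. max (A $$ (Suc i, l)) 0)" by (rule merge)
      finally show "(\<Sum>l\<in>{..<Suc n} - {j}. max (A'' $$ (Suc i, l)) 0) \<le> h (Suc i)"
        using Suc.prems(2)[OF i] by linarith
      have "(\<Sum>l\<in>{..<Suc n} - {j}. max (- A'' $$ (Suc i, l)) 0)
        = (\<Sum>l\<in>{..<Suc n} - {j}. max (- A $$ (Suc i, l) + (if l = k then - A $$ (Suc i, j) else 0)) 0)"
        by (intro sum.cong) (auto simp: ent)
      also have "\<dots> \<le> (\<Sum>l<Suc n. max (- A $$ (Suc i, l)) 0)" by (rule merge)
      finally show "(\<Sum>l\<in>{..<Suc n} - {j}. max (- A'' $$ (Suc i, l)) 0) \<le> h (Suc i)"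
        using Suc.prems(3)[OF i] by linarith
    qed
    ultimately show ?thesis by (simp add: abs_cof)
  qed
  have "det A = (\<Sum>j<Suc n. A $$ (0, j) * C j)"
    unfolding C_def by (rule laplace_expansion_row[OF A]) simp
  moreover have "\<bar>\<Sum>j<Suc n. A $$ (0, j) * C j\<bar> \<le> h 0 * B"
    by (rule abs_sum_mult_le_oscillation) (use Suc.prems(2,3)[of 0] C CC B0 in auto)
  ultimately show ?case
    unfolding prod.lessThan_Suc_shift B_def by simp
qed

subsection \<open>Solution spaces and integer rays\<close>

definition pairing :: "int vec \<Rightarrow> (nat \<Rightarrow> real) \<Rightarrow> real" where
  "pairing \<delta> x = (\<Sum>i<dim_vec \<delta>. of_int (\<delta> $ i) * x i)"

text \<open>A real tuple is a function with first letter \<open>0\<close> that vanishes from \<open>m\<close> on, so that the coordinate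
  deleted from a row plays no role and equality of tuples is equality of functions.\<close>

definition solutions :: "nat \<Rightarrow> int vec set \<Rightarrow> (nat \<Rightarrow> real) set" where
  "solutions m R = {x. x 0 = 0 \<and> (\<forall>i\<ge>m. x i = 0) \<and> (\<forall>\<delta>\<in>R. pairing \<delta> x = 0)}"

text \<open>Dimension at most \<open>k\<close>, witnessed by \<open>k\<close> linear functionals that separate \<open>W\<close> from \<open>0\<close>.\<close>

definition dim_le :: "(nat \<Rightarrow> real) set \<Rightarrow> nat \<Rightarrow> bool" where
  "dim_le W k \<longleftrightarrow> (\<exists>F :: nat \<Rightarrow> (nat \<Rightarrow> real) \<Rightarrow> real.
     (\<forall>j x y t. F j (\<lambda>i. x i + t * y i) = F j x + t * F j y) \<and>
     (\<forall>x\<in>W. (\<forall>j<k. F j x = 0) \<longrightarrow> x = (\<lambda>_. 0)))"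

lemma pairing_add_mult: "pairing \<delta> (\<lambda>i. x i + t * y i) = pairing \<delta> x + t * pairing \<delta> y"
  by (simp add: pairing_def sum.distrib sum_distrib_left algebra_simps)

lemma pairing_mult: "pairing \<delta> (\<lambda>i. t * y i) = t * pairing \<delta> y"
  by (simp add: pairing_def sum_distrib_left algebra_simps)

lemma pairing_zero [simp]: "pairing \<delta> (\<lambda>_. 0) = 0"
  by (simp add: pairing_def)

lemma solutions_add_mult:
  "x \<in> solutions m R \<Longrightarrow> y \<in> solutions m R \<Longrightarrow> (\<lambda>i. x i + t * y i) \<in> solutions m R"
  by (simp add: solutions_def pairing_add_mult)

lemma solutions_mult: "y \<in> solutions m R \<Longrightarrow> (\<lambda>i. t * y i) \<in> solutions m R"
  by (simp add: solutions_def pairing_mult)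

lemma solutions_insert: "solutions m (insert \<delta> R) = {x \<in> solutions m R. pairing \<delta> x = 0}"
  by (auto simp: solutions_def)

lemma zero_in_solutions: "(\<lambda>_. 0) \<in> solutions m R"
  by (simp add: solutions_def)

text \<open>Gaussian elimination: some \<open>F i\<close> is nonzero on \<open>w\<close>, and
  subtracting multiples of it makes the other functionals vanish on \<open>w\<close>. If all of
  these vanish at \<open>x\<close>, then \<open>x\<close> is a multiple of \<open>w\<close>, and
  \<open>pairing \<delta> x = 0\<close> forces the factor to be \<open>0\<close>.\<close>

lemma dim_le_cut:
  assumes dim: "dim_le (solutions m R) (Suc k)"
    and w: "w \<in> solutions m R" "pairing \<delta> w \<noteq> 0"
  shows "dim_le (solutions m (insert \<delta> R)) k"
proof -
  obtain F :: "nat \<Rightarrow> (nat \<Rightarrow> real) \<Rightarrow> real"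
    where lin: "\<And>j x y t. F j (\<lambda>i. x i + t * y i) = F j x + t * F j y"
      and F: "\<And>x. x \<in> solutions m R \<Longrightarrow> (\<And>j. j < Suc k \<Longrightarrow> F j x = 0) \<Longrightarrow> x = (\<lambda>_. 0)"
    using dim unfolding dim_le_def by blast
  have "w \<noteq> (\<lambda>_. 0)" using w by auto
  then obtain i where i: "i < Suc k" "F i w \<noteq> 0" using F[OF w(1)] by blast
  \<comment> \<open>\<open>s\<close> maps the indices below \<open>k\<close> onto those up to
    \<open>k\<close> with the pivot \<open>i\<close> left out.\<close>
  define s where "s j = (if j = i then k else j)" for j
  define G where "G j x = F (s j) x - F (s j) w / F i w * F i x" for j x
  show ?thesis
    unfolding dim_le_def
  proof (intro exI[of _ G] conjI allI ballI impI)
    fix j x y t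
    show "G j (\<lambda>i. x i + t * y i) = G j x + t * G j y"
      by (simp add: G_def lin algebra_simps)
  next
    fix x assume "x \<in> solutions m (insert \<delta> R)" and G0: "\<forall>j<k. G j x = 0"
    then have x: "x \<in> solutions m R" "pairing \<delta> x = 0" by (auto simp: solutions_insert)
    define c where "c = F i x / F i w"
    define z where "z = (\<lambda>i. x i + (- c) * w i)"
    have Fz: "F j z = F j x + (- c) * F j w" for j
      unfolding z_def by (rule lin)
    have "z = (\<lambda>_. 0)"
    proof (rule F)
      show "z \<in> solutions m R" unfolding z_def by (rule solutions_add_mult[OF x(1) w(1)])
    next
      fix j assume j: "j < Suc k"
      show "F j z = 0"
      proof (cases "j = i")
        case True
        then show ?thesis using i by (simp add: Fz c_def)
      next
        case False
        then obtain l where "l < k" "s l = j"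
          using j i by (cases "j = k") (auto simp: s_def less_Suc_eq intro: that[of i] that[of j])
        then have "F j x = F j w / F i w * F i x" using G0 by (auto simp: G_def)
        then show ?thesis by (simp add: Fz c_def)
      qed
    qed
    then have xw: "x = (\<lambda>i. c * w i)" by (auto simp: z_def fun_eq_iff)
    then have "c * pairing \<delta> w = 0" using x(2) pairing_mult[of \<delta> c w] by simp
    then show "x = (\<lambda>_. 0)" using w xw by simp
  qed
qed

section \<open>Masses and integer generators of rays\<close>

lemma sum_neg_part_eq_mass:
  assumes "balanced m \<delta>"
  shows "(\<Sum>i<m. max (- \<delta> $ i) 0) = mass \<delta>"
proof -
  have "(\<Sum>i<m. max (\<delta> $ i) 0) - (\<Sum>i<m. max (- \<delta> $ i) 0) = (\<Sum>i<m. \<delta> $ i)"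
    unfolding sum_subtractf[symmetric] by (intro sum.cong) auto
  then show ?thesis using assms by (auto simp: balanced_def mass_def)
qed

lemma mass_nonneg: "0 \<le> mass \<delta>"
  by (simp add: mass_def sum_nonneg)

lemma pairing_Suc:
  assumes "\<delta> \<in> carrier_vec (Suc n)" and "x 0 = 0"
  shows "pairing \<delta> x = (\<Sum>j<n. of_int (\<delta> $ Suc j) * x (Suc j))"
  using assms by (simp add: pairing_def sum.lessThan_Suc_shift del: sum.lessThan_Suc)

lemma smult_one_mat_unit_vec:
  fixes c :: "'a::comm_ring_1"
  assumes "k < n"
  shows "c \<cdot>\<^sub>m 1\<^sub>m n *\<^sub>v unit_vec n k = c \<cdot>\<^sub>v unit_vec n k"
  by (rule eq_vecI) (use assms in simp_all)

text \<open>Cramer's rule: with the functional \<open>x (m - 1)\<close> as last row the system is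
  square and regular, and the right-hand side \<open>det A\<close> times the last unit vector has an
  integer solution with last coordinate \<open>det A\<close>. The extra row contributes a factor
  \<open>1\<close> to the determinant bound.\<close>

lemma ex_integer_ray:
  fixes L :: "int vec list"
  assumes m: "2 \<le> m"
    and bal: "\<And>\<delta>. \<delta> \<in> set L \<Longrightarrow> balanced m \<delta>"
    and len: "length L \<le> m - 2"
    and line: "\<And>x. x \<in> solutions m (set L) \<Longrightarrow> \<exists>c. x = (\<lambda>i. c * p i)"
    and pos: "0 < p (m - 1)"
  shows "\<exists>y c. 0 < c \<and> (\<forall>i. real_of_int (y i) = c * p i) \<and> y (m - 1) \<le> prod_list (map mass L)"
proof -
  define n where "n = m - 1"
  have mn: "m = Suc n" and n: "0 < n" using m by (auto simp: n_def)
  \<comment> \<open>The rows of \<open>L\<close>, padded with zero rows, and the diameter functional as the last row. The kernel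
    of \<open>A\<close> is trivial, so a posteriori there is no padding.\<close>
  define A :: "int mat" where "A = mat n n (\<lambda>(i, j).
      if i = n - 1 then (if j = n - 1 then 1 else 0)
      else if i < length L then L ! i $ Suc j else 0)"
  define h where "h i = (if i = n - 1 then 1 else if i < length L then mass (L ! i) else 0)" for i
  have A: "A \<in> carrier_mat n n" by (simp add: A_def)
  have bnd: "\<bar>det A\<bar> \<le> (\<Prod>i<n. h i)"
  proof (rule abs_det_le_prod[OF A])
    fix i assume i: "i < n"
    have ent: "A $$ (i, j) = (if i = n - 1 then (if j = n - 1 then 1 else 0)
      else if i < length L then L ! i $ Suc j else 0)" if "j < n" for j
      using i that by (simp add: A_def)
    consider "i = n - 1" | "i \<noteq> n - 1" "i < length L" | "i \<noteq> n - 1" "\<not> i < length L" by blast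
    then have "(\<Sum>j<n. max (A $$ (i, j)) 0) \<le> h i \<and> (\<Sum>j<n. max (- A $$ (i, j)) 0) \<le> h i"
    proof cases
      case 1
      note ent = ent[unfolded 1 One_nat_def]
      have "(\<Sum>j<n. max (A $$ (i, j)) 0) = (\<Sum>j<n. if j = n - 1 then 1 else 0)"
        unfolding 1 by (intro sum.cong) (auto simp: ent)
      moreover have "(\<Sum>j<n. max (- A $$ (i, j)) 0) = (\<Sum>j<n. 0)"
        unfolding 1 by (intro sum.cong) (auto simp: ent)
      ultimately show ?thesis using 1 n by (simp add: h_def)
    next
      case 2
      then have b: "balanced m (L ! i)" using bal by simp
      have "(\<Sum>j<n. max (A $$ (i, j)) 0) = (\<Sum>j<n. max (L ! i $ Suc j) 0)"
        using 2 by (intro sum.cong) (auto simp: ent)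
      also have "\<dots> \<le> (\<Sum>j<m. max (L ! i $ j) 0)"
        unfolding mn by (simp add: sum.lessThan_Suc_shift del: sum.lessThan_Suc)
      also have "\<dots> = h i" using 2 b by (auto simp: h_def mass_def balanced_def)
      finally have p: "(\<Sum>j<n. max (A $$ (i, j)) 0) \<le> h i" .
      have "(\<Sum>j<n. max (- A $$ (i, j)) 0) = (\<Sum>j<n. max (- L ! i $ Suc j) 0)"
        using 2 by (intro sum.cong) (auto simp: ent)
      also have "\<dots> \<le> (\<Sum>j<m. max (- L ! i $ j) 0)"
        unfolding mn by (simp add: sum.lessThan_Suc_shift del: sum.lessThan_Suc)
      also have "\<dots> = h i" using 2 sum_neg_part_eq_mass[OF b] by (simp add: h_def)
      finally show ?thesis using p by simp
    next
      case 3
      then show ?thesis by (simp add: ent h_def)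
    qed
    then show "(\<Sum>j<n. max (A $$ (i, j)) 0) \<le> h i" "(\<Sum>j<n. max (- A $$ (i, j)) 0) \<le> h i"
      by auto
  qed
  \<comment> \<open>Only rows before the last encode relations; \<open>len\<close> places all of
    \<open>L\<close> among them.\<close>
  have lift: "x \<in> solutions m (set L)"
    if "x 0 = 0" "\<And>i. i \<ge> m \<Longrightarrow> x i = 0"
      and *: "\<And>i. i < n - 1 \<Longrightarrow> (\<Sum>j<n. of_int (A $$ (i, j)) * x (Suc j)) = 0" for x
  proof -
    have "pairing \<delta> x = 0" if "\<delta> \<in> set L" for \<delta>
    proof -
      obtain i where i: "i < length L" "\<delta> = L ! i" using \<open>\<delta> \<in> set L\<close> by (auto simp: in_set_conv_nth)
      then have "i < n - 1" using len mn by simp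
      have "pairing \<delta> x = (\<Sum>j<n. of_int (\<delta> $ Suc j) * x (Suc j))"
        using bal[OF \<open>\<delta> \<in> set L\<close>] \<open>x 0 = 0\<close> by (intro pairing_Suc) (auto simp: balanced_def mn)
      also have "\<dots> = (\<Sum>j<n. of_int (A $$ (i, j)) * x (Suc j))"
        using i \<open>i < n - 1\<close> by (intro sum.cong) (auto simp: A_def)
      finally show ?thesis using *[OF \<open>i < n - 1\<close>] by simp
    qed
    then show ?thesis using that by (simp add: solutions_def)
  qed
  have det0: "det A \<noteq> 0"
  proof
    assume "det A = 0"
    define B where "B = map_mat real_of_int A"
    have B: "B \<in> carrier_mat n n" using A by (simp add: B_def)
    have "det B = 0" using \<open>det A = 0\<close> by (simp add: B_def of_int_hom.hom_det)
    then obtain v where v: "v \<in> carrier_vec n" "v \<noteq> 0\<^sub>v n" "B *\<^sub>v v = 0\<^sub>v n"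
      using det_0_iff_vec_prod_zero[OF B] by auto
    define x where "x i = (if i = 0 \<or> m \<le> i then 0 else v $ (i - 1))" for i
    have row: "(\<Sum>j<n. of_int (A $$ (i, j)) * v $ j) = 0" if "i < n" for i
    proof -
      have "(B *\<^sub>v v) $ i = 0" using v that by simp
      then show ?thesis using that A v(1) by (simp add: B_def scalar_prod_def atLeast0LessThan)
    qed
    have xS: "x (Suc j) = v $ j" if "j < n" for j using that by (simp add: x_def mn)
    have "x \<in> solutions m (set L)"
      by (rule lift) (use row xS in \<open>auto simp: x_def[of 0] x_def[of i for i] mn\<close>)
    then obtain c where c: "x = (\<lambda>i. c * p i)" using line by blast
    have "(\<Sum>j<n. of_int (A $$ (n - 1, j)) * v $ j) = (\<Sum>j<n. if j = n - 1 then v $ j else 0)"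
      using n by (intro sum.cong) (auto simp: A_def)
    then have "v $ (n - 1) = 0" using row[of "n - 1"] n by simp
    then have "x (m - 1) = 0" using n by (simp add: x_def mn)
    then have "c = 0" using c pos by simp
    then have "v $ j = 0" if "j < n" for j using xS[OF that] c by simp
    then show False using v by (auto intro: eq_vecI)
  qed
  \<comment> \<open>A padding row would have \<open>h = 0\<close>, and the determinant bound would
    force \<open>det A = 0\<close>.\<close>
  have len_eq: "length L = n - 1"
  proof (rule ccontr)
    assume "length L \<noteq> n - 1"
    then have "length L < n - 1" using len mn by simp
    then have "h (length L) = 0" "length L \<in> {..<n}" by (auto simp: h_def)
    then have "(\<Prod>i<n. h i) = 0" by (meson finite_lessThan prod_zero)
    then show False using bnd det0 by (simp only: abs_le_zero_iff)
  qed
  have "(\<Prod>i<n. h i) = (\<Prod>i<n - 1. h i) * h (n - 1)"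
    using n by (cases n) auto
  also have "\<dots> = (\<Prod>i<length L. mass (L ! i))"
    by (simp add: h_def len_eq)
  also have "\<dots> = prod_list (map mass L)"
    by (simp add: prod.list_conv_set_nth atLeast0LessThan)
  finally have prod: "(\<Prod>i<n. h i) = prod_list (map mass L)" .
  define w where "w = adj_mat A *\<^sub>v unit_vec n (n - 1)"
  have w: "w \<in> carrier_vec n" using adj_mat(1)[OF A] by (simp add: w_def)
  have "A *\<^sub>v w = det A \<cdot>\<^sub>m 1\<^sub>m n *\<^sub>v unit_vec n (n - 1)"
    unfolding w_def adj_mat(2)[OF A, symmetric] using adj_mat(1)[OF A] A
    by (simp add: assoc_mult_mat_vec[of _ n n _ n])
  also have "\<dots> = det A \<cdot>\<^sub>v unit_vec n (n - 1)"
    using n by (intro smult_one_mat_unit_vec) simp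
  finally have Aw: "A *\<^sub>v w = det A \<cdot>\<^sub>v unit_vec n (n - 1)" .
  have row: "(\<Sum>j<n. A $$ (i, j) * w $ j) = (if i = n - 1 then det A else 0)" if "i < n" for i
  proof -
    have "(A *\<^sub>v w) $ i = (if i = n - 1 then det A else 0)"
      unfolding Aw using that n by simp
    then show ?thesis using that A w by (simp add: scalar_prod_def atLeast0LessThan)
  qed
  \<comment> \<open>The factor \<open>sgn (det A)\<close> turns the last letter into
    \<open>\<bar>det A\<bar>\<close>, so that \<open>y\<close> is a positive multiple of
    \<open>p\<close>.\<close>
  define y where "y i = (if i = 0 \<or> m \<le> i then 0 else sgn (det A) * w $ (i - 1))" for i
  have yS: "y (Suc j) = sgn (det A) * w $ j" if "j < n" for j using that by (simp add: y_def mn)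
  have "(\<lambda>i. real_of_int (y i)) \<in> solutions m (set L)"
  proof (rule lift)
    fix i assume i: "i < n - 1"
    have "(\<Sum>j<n. real_of_int (A $$ (i, j)) * real_of_int (y (Suc j)))
        = real_of_int (sgn (det A) * (\<Sum>j<n. A $$ (i, j) * w $ j))"
      by (simp add: sum_distrib_left yS algebra_simps)
    then show "(\<Sum>j<n. real_of_int (A $$ (i, j)) * real_of_int (y (Suc j))) = 0"
      using row[of i] i by simp
  qed (auto simp: y_def)
  then obtain c where c: "(\<lambda>i. real_of_int (y i)) = (\<lambda>i. c * p i)" using line by blast
  have "(\<Sum>j<n. A $$ (n - 1, j) * w $ j) = (\<Sum>j<n. if j = n - 1 then w $ j else 0)"
    using n by (intro sum.cong) (auto simp: A_def)
  then have "w $ (n - 1) = det A" using row[of "n - 1"] n by simp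
  then have yl: "y (m - 1) = \<bar>det A\<bar>"
    using n by (simp add: y_def mn abs_sgn)
  have "c * p (m - 1) = real_of_int \<bar>det A\<bar>" using fun_cong[OF c, of "m - 1"] yl by simp
  then have "0 < c * p (m - 1)" using det0 by simp
  then have "0 < c" using pos by (simp add: zero_less_mult_iff)
  moreover have "\<forall>i. real_of_int (y i) = c * p i" using c by (simp add: fun_eq_iff)
  moreover have "y (m - 1) \<le> prod_list (map mass L)" using yl bnd prod by simp
  ultimately show ?thesis by blast
qed

subsection \<open>Gaps and facets\<close>

definition gap :: "nat \<Rightarrow> nat \<Rightarrow> int vec" where
  "gap m i = vec m (\<lambda>j. if j = Suc i then 1 else if j = i then - 1 else 0)"

text \<open>Relative interior of the cone of weakly increasing tuples in the solution space.\<close>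

definition interior_point :: "nat \<Rightarrow> int vec set \<Rightarrow> (nat \<Rightarrow> real) \<Rightarrow> bool" where
  "interior_point m R x \<longleftrightarrow> x \<in> solutions m R \<and>
     (\<forall>i. Suc i < m \<longrightarrow> (\<forall>z\<in>solutions m R. pairing (gap m i) z = 0) \<or> 0 < pairing (gap m i) x)"

lemma pairing_gap:
  assumes "Suc i < m"
  shows "pairing (gap m i) x = x (Suc i) - x i"
proof -
  have "pairing (gap m i) x
      = (\<Sum>j<m. (if j = Suc i then x j else 0) - (if j = i then x j else 0))"
    unfolding pairing_def by (rule sum.cong) (auto simp: gap_def)
  also have "\<dots> = x (Suc i) - x i"
    using assms by (simp add: sum_subtractf)
  finally show ?thesis .
qed

lemma mass_gap:
  assumes "Suc i < m"
  shows "mass (gap m i) = 1"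
proof -
  have "mass (gap m i) = (\<Sum>j<m. if j = Suc i then 1 else 0)"
    unfolding mass_def by (rule sum.cong) (auto simp: gap_def)
  then show ?thesis using assms by simp
qed

lemma balanced_gap:
  assumes "Suc i < m"
  shows "balanced m (gap m i)"
proof -
  have "(\<Sum>j<m. gap m i $ j) = (\<Sum>j<m. (if j = Suc i then 1 else 0) - (if j = i then 1 else 0))"
    by (rule sum.cong) (auto simp: gap_def)
  also have "\<dots> = 0"
    using assms by (simp add: sum_subtractf)
  finally show ?thesis by (simp add: balanced_def gap_def)
qed

lemma q_relation_gap: "Suc i < m \<Longrightarrow> 1 \<le> q \<Longrightarrow> q_relation m q (gap m i)"
  by (simp add: q_relation_def balanced_gap mass_gap)

text \<open>Entries lie between \<open>- q\<close> and \<open>q\<close>, because the negative parts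
  of a balanced vector also sum to its mass.\<close>

lemma finite_q_relations: "finite {\<delta>. q_relation m q \<delta>}"
proof (rule finite_subset)
  show "finite (vec_of_list ` {xs. set xs \<subseteq> {- int q..int q} \<and> length xs = m})"
    by (intro finite_imageI finite_lists_length_eq) simp
  show "{\<delta>. q_relation m q \<delta>} \<subseteq> vec_of_list ` {xs. set xs \<subseteq> {- int q..int q} \<and> length xs = m}"
  proof
    fix \<delta> assume "\<delta> \<in> {\<delta>. q_relation m q \<delta>}"
    then have b: "balanced m \<delta>" and q: "mass \<delta> \<le> int q" by (auto simp: q_relation_def)
    then have d: "dim_vec \<delta> = m" by (auto simp: balanced_def)
    have "\<delta> $ i \<in> {- int q..int q}" if i: "i < m" for i
    proof -
      have "max (\<delta> $ i) 0 \<le> mass \<delta>"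
        unfolding mass_def d using i by (intro member_le_sum) auto
      moreover have "max (- \<delta> $ i) 0 \<le> mass \<delta>"
        unfolding sum_neg_part_eq_mass[OF b, symmetric] using i by (intro member_le_sum) auto
      ultimately show ?thesis using q by auto
    qed
    then have "set (list_of_vec \<delta>) \<subseteq> {- int q..int q}"
      using d by (auto simp: set_list_of_vec vec_set_def)
    then show "\<delta> \<in> vec_of_list ` {xs. set xs \<subseteq> {- int q..int q} \<and> length xs = m}"
      using d by (intro image_eqI[of _ _ "list_of_vec \<delta>"]) (auto simp: vec_list)
  qed
qed

section \<open>Pointedness of the cone and its facets\<close>

lemma eq_zero_if_gaps_zero:
  assumes "x \<in> solutions m R" and "\<And>i. Suc i < m \<Longrightarrow> pairing (gap m i) x = 0"
  shows "x = (\<lambda>_. 0)"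
proof
  fix i
  have "i < m \<Longrightarrow> x i = 0"
  proof (induction i)
    case 0
    then show ?case using assms(1) by (simp add: solutions_def)
  next
    case (Suc i)
    then show ?case using assms(2)[of i] by (simp add: pairing_gap)
  qed
  then show "x i = 0"
    using assms(1) by (cases "i < m") (auto simp: solutions_def)
qed

text \<open>The ratio test of linear programming: \<open>t\<close> is the least quotient
  \<open>a i / - b i\<close> over the decreasing coordinates, and \<open>ab\<close> makes it
  positive.\<close>

lemma ex_first_hit:
  fixes a b :: "'i \<Rightarrow> real"
  assumes fin: "finite I" and a: "\<And>i. i \<in> I \<Longrightarrow> 0 \<le> a i"
    and ab: "\<And>i. i \<in> I \<Longrightarrow> b i < 0 \<Longrightarrow> 0 < a i" and ex: "\<exists>i\<in>I. b i < 0"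
  shows "\<exists>t>0. (\<forall>i\<in>I. 0 \<le> a i + t * b i) \<and> (\<exists>i\<in>I. b i < 0 \<and> a i + t * b i = 0)"
proof -
  define J where "J = {i \<in> I. b i < 0}"
  define t where "t = Min ((\<lambda>i. a i / - b i) ` J)"
  have J: "finite J" "J \<noteq> {}" using fin ex by (auto simp: J_def)
  have "t \<in> (\<lambda>i. a i / - b i) ` J" unfolding t_def using J by (intro Min_in) auto
  then obtain j where j: "j \<in> J" "t = a j / - b j" by blast
  have t0: "0 < t" using j ab[of j] by (simp add: J_def divide_pos_neg)
  have "0 \<le> a i + t * b i" if i: "i \<in> I" for i
  proof (cases "b i < 0")
    case True
    then have "t \<le> a i / - b i" unfolding t_def using J i by (intro Min_le) (auto simp: J_def)
    moreover have "t \<le> a i / - b i \<longleftrightarrow> t * - b i \<le> a i"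
      using True by (intro pos_le_divide_eq) simp
    ultimately show ?thesis by simp
  next
    case False
    then show ?thesis using a[OF i] t0 by simp
  qed
  moreover have "a j + t * b j = 0" using j by (simp add: J_def)
  ultimately show ?thesis using t0 j(1) by (auto simp: J_def)
qed

text \<open>One plus the sum of all quotients exceeds each of them. This replaces a small
  perturbation of \<open>a\<close> by \<open>b\<close> without an epsilon.\<close>

lemma ex_dominating_multiple:
  fixes a b :: "'i \<Rightarrow> real"
  assumes fin: "finite I" and a: "\<And>i. i \<in> I \<Longrightarrow> 0 < a i"
  shows "\<exists>N>0. \<forall>i\<in>I. 0 < b i + N * a i"
proof -
  define N where "N = 1 + (\<Sum>i\<in>I. \<bar>b i\<bar> / a i)"
  have nn: "0 \<le> \<bar>b i\<bar> / a i" if "i \<in> I" for i using a[OF that] by simp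
  have "0 < b i + N * a i" if i: "i \<in> I" for i
  proof -
    have "\<bar>b i\<bar> / a i < N"
      unfolding N_def using member_le_sum[of i I "\<lambda>i. \<bar>b i\<bar> / a i"] i nn fin by fastforce
    then show ?thesis using a[OF i] by (simp add: pos_divide_less_eq)
  qed
  moreover have "0 < N" unfolding N_def using nn by (simp add: add_pos_nonneg sum_nonneg)
  ultimately show ?thesis by blast
qed

text \<open>Drives the descent along a flag: the gap being positive at \<open>x0\<close> means that
  cutting by it lowers the dimension, and the new point keeps the facet eligible for the next
  descent.\<close>

lemma ex_facet:
  assumes x0: "interior_point m R x0"
    and z0: "z0 \<in> solutions m R" "z0 \<noteq> (\<lambda>_. 0)"
  shows "\<exists>i x. Suc i < m \<and> 0 < pairing (gap m i) x0 \<and> interior_point m (insert (gap m i) R) x"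
proof -
  define S where "S = solutions m R"
  define g where "g i = pairing (gap m i)" for i
  define G where "G = {i. Suc i < m \<and> (\<exists>z\<in>S. g i z \<noteq> 0)}"
  define tight where "tight x = {i \<in> G. g i x = 0}" for x
  \<comment> \<open>A point with the fewest tight gaps is relatively interior to a facet: otherwise, moving from \<open>x0\<close>
    in a direction along which the tight gap \<open>i\<close> is constant until another tight gap closes, and adding a large
    multiple of the point, leaves fewer tight gaps, but not none.\<close>
  define cand where "cand x \<longleftrightarrow> x \<in> S \<and> (\<forall>i. Suc i < m \<longrightarrow> 0 \<le> g i x) \<and> tight x \<noteq> {}" for x
  have G: "finite G" by (rule finite_subset[of _ "{..<m}"]) (auto simp: G_def)
  have g_add: "g i (\<lambda>j. x j + t * y j) = g i x + t * g i y" for i x t y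
    by (simp add: g_def pairing_add_mult)
  have x0S: "x0 \<in> S"
    using x0 by (simp add: interior_point_def S_def)
  have x0G: "0 < g i x0" if "i \<in> G" for i
    using x0 that by (auto simp: interior_point_def G_def S_def g_def)
  have nG: "g i x = 0" if "Suc i < m" "i \<notin> G" "x \<in> S" for i x
    using that by (auto simp: G_def)
  obtain i0 where "i0 \<in> G"
    using eq_zero_if_gaps_zero[OF z0(1)] z0 by (auto simp: G_def S_def g_def)
  then have "cand (\<lambda>_. 0)"
    by (auto simp: cand_def S_def zero_in_solutions g_def tight_def)
  then obtain x1 where x1: "cand x1" and least: "\<And>x. cand x \<Longrightarrow> card (tight x1) \<le> card (tight x)"
    using ex_has_least_nat[of cand _ "\<lambda>x. card (tight x)"] by blast
  have x1S: "x1 \<in> S" and x1nn: "\<And>i. Suc i < m \<Longrightarrow> 0 \<le> g i x1"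
    using x1 by (auto simp: cand_def)
  obtain i where i: "i \<in> tight x1" using x1 by (auto simp: cand_def)
  then have iG: "i \<in> G" "g i x1 = 0" "Suc i < m" by (auto simp: tight_def G_def)
  have "g j z = 0" if j: "Suc j < m" "\<not> 0 < g j x1" and z: "z \<in> S" "g i z = 0" for j z
  proof (rule ccontr)
    assume nz: "g j z \<noteq> 0"
    have jt: "j \<in> tight x1" using j x1nn[OF j(1)] nz z by (auto simp: tight_def G_def)
    \<comment> \<open>The factor makes \<open>g j w\<close> minus a square, hence negative, so some
      tight gap closes in direction \<open>w\<close>; meanwhile \<open>g i w = 0\<close> keeps gap
      \<open>i\<close> at its positive value at \<open>x0\<close>.\<close>
    define w where "w = (\<lambda>l. - g j z * z l)"
    have wS: "w \<in> S" using z unfolding w_def S_def by (blast intro: solutions_mult)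
    have gw: "g l w = - g j z * g l z" for l unfolding w_def g_def by (rule pairing_mult)
    have "\<exists>t>0. (\<forall>l\<in>tight x1. 0 \<le> g l x0 + t * g l w) \<and>
        (\<exists>l\<in>tight x1. g l w < 0 \<and> g l x0 + t * g l w = 0)"
    proof (rule ex_first_hit)
      show "finite (tight x1)" using G by (simp add: tight_def)
      show "0 \<le> g l x0" "0 < g l x0" if "l \<in> tight x1" for l
        using x0G[of l] that by (auto simp: tight_def)
      show "\<exists>l\<in>tight x1. g l w < 0" using jt nz by (auto simp: gw intro!: bexI[of _ j] zero_less_mult_iff[THEN iffD2])
    qed
    then obtain t k where t: "\<And>l. l \<in> tight x1 \<Longrightarrow> 0 \<le> g l x0 + t * g l w"
      and k: "k \<in> tight x1" "g k x0 + t * g k w = 0" by blast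
    define z' where "z' = (\<lambda>l. x0 l + t * w l)"
    have z'S: "z' \<in> S" unfolding z'_def using x0S wS by (auto simp: S_def intro: solutions_add_mult)
    have gz': "g l z' = g l x0 + t * g l w" for l unfolding z'_def by (rule g_add)
    have pos: "0 < g l x1" if "l \<in> G - tight x1" for l
      using that x1nn[of l] by (auto simp: tight_def G_def less_le)
    have "\<exists>N>0. \<forall>l\<in>G - tight x1. 0 < g l z' + N * g l x1"
      using G pos by (intro ex_dominating_multiple) auto
    then obtain N where N: "\<And>l. l \<in> G - tight x1 \<Longrightarrow> 0 < g l z' + N * g l x1" by blast
    define x2 where "x2 = (\<lambda>l. z' l + N * x1 l)"
    have gx2: "g l x2 = g l z' + N * g l x1" for l unfolding x2_def by (rule g_add)
    have x2S: "x2 \<in> S" unfolding x2_def using z'S x1S by (auto simp: S_def intro: solutions_add_mult)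
    have t1: "g l x2 = g l z'" if "l \<in> tight x1" for l using that by (simp add: gx2 tight_def)
    have nn: "0 \<le> g l x2" if "Suc l < m" for l
    proof -
      consider "l \<notin> G" | "l \<in> tight x1" | "l \<in> G - tight x1" by blast
      then show ?thesis
      proof cases
        case 1
        then show ?thesis using nG[OF that 1 x2S] by simp
      next
        case 2
        then show ?thesis using t[OF 2] by (simp add: t1 gz')
      next
        case 3
        then show ?thesis using N[OF 3] by (simp add: gx2)
      qed
    qed
    have "k \<in> tight x2" using k t1[OF k(1)] by (simp add: tight_def gz')
    then have "cand x2" using x2S nn by (auto simp: cand_def)
    moreover have "tight x2 \<subset> tight x1"
    proof
      show "tight x2 \<subseteq> tight x1"
      proof
        fix l assume l: "l \<in> tight x2"
        show "l \<in> tight x1"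
        proof (rule ccontr)
          assume "l \<notin> tight x1"
          then have "0 < g l x2" using N[of l] l by (simp add: tight_def gx2)
          then show False using l by (simp add: tight_def)
        qed
      qed
      have "g i x2 = g i x0" using t1[OF i] z by (simp add: gz' gw)
      then have "i \<notin> tight x2" using x0G[OF iG(1)] by (simp add: tight_def)
      then show "tight x2 \<noteq> tight x1" using i by blast
    qed
    moreover have "finite (tight x1)" using G by (simp add: tight_def)
    ultimately show False
      using least[of x2] psubset_card_mono[of "tight x1" "tight x2"] by linarith
  qed
  then have "interior_point m (insert (gap m i) R) x1"
    using x1S iG by (auto simp: interior_point_def solutions_insert S_def g_def)
  then show ?thesis using iG x0G[OF iG(1)] by (auto simp: g_def)
qed

subsection \<open>Generic integer points\<close>

text \<open>\<open>s\<close> prescribes a side of each hyperplane, and \<open>p0\<close> witnesses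
  that the closed chamber reaches the side where \<open>\<gamma>\<close> is positive. The last
  clause of the conclusion expresses extremality of the ray through \<open>p\<close>.\<close>

lemma ex_chamber_ray:
  fixes s :: "int vec \<Rightarrow> real" and m q :: nat and R :: "int vec set"
  defines "S \<equiv> solutions m R"
  defines "Q \<equiv> {\<delta>. q_relation m q \<delta> \<and> (\<exists>z\<in>S. pairing \<delta> z \<noteq> 0)}"
  assumes q: "1 \<le> q" and s: "\<And>\<delta>. \<delta> \<in> Q \<Longrightarrow> s \<delta> \<noteq> 0"
    and p0: "p0 \<in> S" "\<And>\<delta>. \<delta> \<in> Q \<Longrightarrow> 0 \<le> s \<delta> * pairing \<delta> p0" "0 < pairing \<gamma> p0"
  shows "\<exists>p\<in>S. (\<forall>\<delta>\<in>Q. 0 \<le> s \<delta> * pairing \<delta> p) \<and> 0 < pairing \<gamma> p \<and>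
    (\<forall>u\<in>S. (\<forall>\<delta>\<in>Q. pairing \<delta> p = 0 \<longrightarrow> pairing \<delta> u = 0) \<longrightarrow> (\<exists>c. u = (\<lambda>i. c * p i)))"
proof -
  have Q: "finite Q"
    by (rule finite_subset[OF _ finite_q_relations[of m q]]) (auto simp: Q_def)
  \<comment> \<open>A point of the chamber with the most tight relations spans an extreme ray; keeping the value of
    \<open>\<gamma>\<close> fixed throughout ensures that this ray is not in the hyperplane of \<open>\<gamma>\<close>.\<close>
  define loose where "loose p = {\<delta> \<in> Q. pairing \<delta> p \<noteq> 0}" for p
  define cand where "cand p \<longleftrightarrow> p \<in> S \<and> (\<forall>\<delta>\<in>Q. 0 \<le> s \<delta> * pairing \<delta> p) \<and> 0 < pairing \<gamma> p" for p
  have "cand p0" using p0 by (simp add: cand_def)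
  then obtain p where p: "cand p" and least: "\<And>x. cand x \<Longrightarrow> card (loose p) \<le> card (loose x)"
    using ex_has_least_nat[of cand _ "\<lambda>x. card (loose x)"] by blast
  have pS: "p \<in> S" and p_nn: "\<And>\<delta>. \<delta> \<in> Q \<Longrightarrow> 0 \<le> s \<delta> * pairing \<delta> p" and p_pos: "0 < pairing \<gamma> p"
    using p by (auto simp: cand_def)
  have "\<exists>c. u = (\<lambda>i. c * p i)"
    if u: "u \<in> S" "\<And>\<delta>. \<delta> \<in> Q \<Longrightarrow> pairing \<delta> p = 0 \<Longrightarrow> pairing \<delta> u = 0" for u
  proof -
    \<comment> \<open>With this factor \<open>w\<close> is annihilated by \<open>\<gamma>\<close>,
      so moving along \<open>w\<close> keeps the value of \<open>\<gamma>\<close>.\<close>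
    define c where "c = pairing \<gamma> u / pairing \<gamma> p"
    define w where "w = (\<lambda>i. u i + (- c) * p i)"
    have wS: "w \<in> S" unfolding w_def using u pS unfolding S_def by (intro solutions_add_mult)
    have pw: "pairing \<delta> w = pairing \<delta> u + (- c) * pairing \<delta> p" for \<delta>
      unfolding w_def by (rule pairing_add_mult)
    have w_tight: "pairing \<delta> w = 0" if "\<delta> \<in> Q" "pairing \<delta> p = 0" for \<delta>
      using u(2)[OF that] that by (simp add: pw)
    have w_\<gamma>: "pairing \<gamma> w = 0" using p_pos by (simp add: pw c_def)
    have "w = (\<lambda>_. 0)"
    proof (rule ccontr)
      assume "w \<noteq> (\<lambda>_. 0)"
      \<comment> \<open>Gaps are themselves \<open>q\<close>-relations, so the chamber contains no
        line and a nonzero \<open>w\<close>, with a suitable sign, leads to a wall.\<close>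
      then obtain k where k: "Suc k < m" "pairing (gap m k) w \<noteq> 0"
        using eq_zero_if_gaps_zero wS unfolding S_def by blast
      define \<beta> where "\<beta> = gap m k"
      have \<beta>: "\<beta> \<in> Q" "pairing \<beta> w \<noteq> 0"
        using k wS q by (auto simp: \<beta>_def Q_def intro: q_relation_gap)
      define w' where "w' = (\<lambda>i. - (s \<beta> * pairing \<beta> w) * w i)"
      have w'S: "w' \<in> S" unfolding w'_def using wS unfolding S_def by (rule solutions_mult)
      have pw': "pairing \<delta> w' = - (s \<beta> * pairing \<beta> w) * pairing \<delta> w" for \<delta>
        unfolding w'_def by (rule pairing_mult)
      have "\<exists>t>0. (\<forall>\<delta>\<in>Q. 0 \<le> s \<delta> * pairing \<delta> p + t * (s \<delta> * pairing \<delta> w')) \<and>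
          (\<exists>\<delta>\<in>Q. s \<delta> * pairing \<delta> w' < 0 \<and> s \<delta> * pairing \<delta> p + t * (s \<delta> * pairing \<delta> w') = 0)"
      proof (rule ex_first_hit[OF Q p_nn])
        fix \<delta> assume \<delta>: "\<delta> \<in> Q" "s \<delta> * pairing \<delta> w' < 0"
        then have "pairing \<delta> p \<noteq> 0" using w_tight[OF \<delta>(1)] by (auto simp: pw')
        then show "0 < s \<delta> * pairing \<delta> p" using p_nn[OF \<delta>(1)] s[OF \<delta>(1)] by (simp add: less_le)
      next
        have "s \<beta> * pairing \<beta> w' = - ((s \<beta> * pairing \<beta> w) * (s \<beta> * pairing \<beta> w))"
          by (simp add: pw')
        also have "\<dots> < 0" using \<beta>(2) s[OF \<beta>(1)] not_real_square_gt_zero[of "s \<beta> * pairing \<beta> w"]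
          by (simp del: not_real_square_gt_zero)
        finally show "\<exists>\<delta>\<in>Q. s \<delta> * pairing \<delta> w' < 0" using \<beta>(1) by blast
      qed
      then obtain t \<delta> where t: "\<And>\<delta>. \<delta> \<in> Q \<Longrightarrow> 0 \<le> s \<delta> * pairing \<delta> p + t * (s \<delta> * pairing \<delta> w')"
        and \<delta>: "\<delta> \<in> Q" "s \<delta> * pairing \<delta> w' < 0" "s \<delta> * pairing \<delta> p + t * (s \<delta> * pairing \<delta> w') = 0"
        by blast
      define p' where "p' = (\<lambda>i. p i + t * w' i)"
      have p'S: "p' \<in> S" unfolding p'_def using pS w'S unfolding S_def by (rule solutions_add_mult)
      have pp': "pairing \<alpha> p' = pairing \<alpha> p + t * pairing \<alpha> w'" for \<alpha>
        unfolding p'_def by (rule pairing_add_mult)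
      have "cand p'"
        using p'S p_pos t by (simp add: cand_def pp' pw' w_\<gamma> algebra_simps)
      moreover have "loose p' \<subset> loose p"
      proof
        show "loose p' \<subseteq> loose p"
          using w_tight by (auto simp: loose_def pp' pw')
        have "s \<delta> * pairing \<delta> p' = 0" using \<delta>(3) by (simp add: pp' algebra_simps)
        then have "\<delta> \<notin> loose p'" using s[OF \<delta>(1)] by (simp add: loose_def)
        moreover have "\<delta> \<in> loose p" using \<delta> w_tight[OF \<delta>(1)] by (auto simp: loose_def pw')
        ultimately show "loose p' \<noteq> loose p" by blast
      qed
      moreover have "finite (loose p)" using Q by (simp add: loose_def)
      ultimately show False
        using least[of p'] psubset_card_mono[of "loose p" "loose p'"] by linarith
    qed
    then show ?thesis by (intro exI[of _ c]) (simp add: w_def fun_eq_iff)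
  qed
  then show ?thesis using pS p_nn p_pos by blast
qed

text \<open>Each vector of \<open>D\<close> that is nonzero somewhere on the current solution space
  lowers the dimension bound by one. The nonzero \<open>p\<close> survives all cuts, so starting
  from \<open>Suc k\<close> at most \<open>k\<close> cuts are possible.\<close>

lemma ex_cutting_list:
  assumes "dim_le (solutions m (set L)) (Suc k)"
    and "p \<in> solutions m (set L)" and "p \<noteq> (\<lambda>_. 0)"
    and "\<And>\<delta>. \<delta> \<in> D \<Longrightarrow> pairing \<delta> p = 0"
    and "\<And>u. u \<in> solutions m (set L) \<Longrightarrow> (\<And>\<delta>. \<delta> \<in> D \<Longrightarrow> pairing \<delta> u = 0) \<Longrightarrow> \<exists>c. u = (\<lambda>i. c * p i)"
  shows "\<exists>M. set M \<subseteq> D \<and> length M \<le> k \<and>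
    (\<forall>u\<in>solutions m (set (M @ L)). \<exists>c. u = (\<lambda>i. c * p i))"
  using assms
proof (induction k arbitrary: L)
  case 0
  have "\<exists>c. u = (\<lambda>i. c * p i)" if u: "u \<in> solutions m (set L)" for u
  proof (rule "0.prems"(5)[OF u], rule ccontr)
    fix \<delta> assume \<delta>: "\<delta> \<in> D" "pairing \<delta> u \<noteq> 0"
    then have "dim_le (solutions m (insert \<delta> (set L))) 0"
      using "0.prems"(1) u by (intro dim_le_cut)
    moreover have "p \<in> solutions m (insert \<delta> (set L))"
      using "0.prems"(2,4) \<delta> by (simp add: solutions_insert)
    ultimately show False using "0.prems"(3) by (auto simp: dim_le_def)
  qed
  then show ?case by (intro exI[of _ "[]"]) auto
next
  case (Suc k)
  show ?case
  proof (cases "\<forall>u\<in>solutions m (set L). \<forall>\<delta>\<in>D. pairing \<delta> u = 0")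
    case True
    then show ?thesis using Suc.prems(5) by (intro exI[of _ "[]"]) auto
  next
    case False
    then obtain u \<delta> where u: "u \<in> solutions m (set L)" and \<delta>: "\<delta> \<in> D" "pairing \<delta> u \<noteq> 0" by blast
    have "\<exists>M. set M \<subseteq> D \<and> length M \<le> k \<and>
      (\<forall>u\<in>solutions m (set (M @ \<delta> # L)). \<exists>c. u = (\<lambda>i. c * p i))"
    proof (rule Suc.IH)
      show "dim_le (solutions m (set (\<delta> # L))) (Suc k)"
        using dim_le_cut[OF Suc.prems(1) u \<delta>(2)] by simp
      show "p \<in> solutions m (set (\<delta> # L))"
        using Suc.prems(2,4) \<delta> by (simp add: solutions_insert)
    qed (use Suc.prems(3,4,5) in \<open>simp_all add: solutions_insert\<close>)
    then obtain M where "set M \<subseteq> D" "length M \<le> k"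
      "\<forall>u\<in>solutions m (set (M @ \<delta> # L)). \<exists>c. u = (\<lambda>i. c * p i)" by blast
    then show ?thesis using \<delta> by (intro exI[of _ "M @ [\<delta>]"]) auto
  qed
qed

lemma prod_list_mass_le:
  assumes "\<And>\<delta>. \<delta> \<in> set M \<Longrightarrow> mass \<delta> \<le> int q" and "length M \<le> k" and "1 \<le> q"
  shows "prod_list (map mass M) \<le> int q ^ k"
proof -
  have "prod_list (map mass M) \<le> int q ^ length M"
    using assms(1)
  proof (induction M)
    case (Cons \<delta> M)
    then show ?case
      by (auto intro!: mult_mono prod_list_nonneg simp: mass_nonneg)
  qed simp
  also have "\<dots> \<le> int q ^ k" using assms(2,3) by (intro power_increasing) auto
  finally show ?thesis .
qed

lemma gaps_nonneg_mono:
  assumes "\<And>i. Suc i < m \<Longrightarrow> 0 \<le> pairing (gap m i) x" and "a \<le> b" and "b < m"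
  shows "x a \<le> x b"
  using assms(2,3)
proof (induction b rule: dec_induct)
  case (step b)
  then show ?case using assms(1)[of b] by (simp add: pairing_gap)
qed simp

text \<open>In a trivial solution space all relations vanish identically, so the zero tuple
  qualifies. This covers the base case and also a dimension bound that is not attained.\<close>

lemma zero_generic:
  assumes "\<And>z. z \<in> solutions m (set L) \<Longrightarrow> z = (\<lambda>_. 0)"
  shows "\<exists>y :: nat \<Rightarrow> int. interior_point m (set L) (\<lambda>i. of_int (y i)) \<and>
    (\<forall>\<delta>. q_relation m q \<delta> \<longrightarrow> (\<exists>z\<in>solutions m (set L). pairing \<delta> z \<noteq> 0) \<longrightarrow>
       pairing \<delta> (\<lambda>i. of_int (y i)) \<noteq> 0) \<and>
    y (m - 1) \<le> prod_list (map mass L) * (\<Sum>j<k. int q ^ j)"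
proof -
  have "0 \<le> prod_list (map mass L) * (\<Sum>j<k. int q ^ j)"
    by (auto intro!: mult_nonneg_nonneg prod_list_nonneg sum_nonneg simp: mass_nonneg)
  moreover have "pairing \<delta> z = 0" if "z \<in> solutions m (set L)" for \<delta> z
    using assms[OF that] by simp
  ultimately show ?thesis
    using zero_in_solutions[of m "set L"]
    by (intro exI[of _ "\<lambda>_. 0"]) (auto simp: interior_point_def)
qed

text \<open>Induction on \<open>k\<close>. Passing to a facet adds a gap of mass \<open>1\<close> to
  \<open>L\<close>, which leaves the product of masses unchanged; the ray added in the step to
  \<open>Suc k\<close> costs at most \<open>q ^ k\<close> times that product. The bound on
  \<open>length L + k\<close> leaves room for the diameter row of the determinant. As
  \<open>y 0 = 0\<close>, the last letter is the diameter.\<close>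

lemma ex_generic_integer_point:
  assumes m: "2 \<le> m" and q: "1 \<le> q"
    and bal: "\<And>\<delta>. \<delta> \<in> set L \<Longrightarrow> balanced m \<delta>"
    and dim: "dim_le (solutions m (set L)) k" and len: "length L + k \<le> m - 1"
    and x0: "interior_point m (set L) x0"
  shows "\<exists>y :: nat \<Rightarrow> int. interior_point m (set L) (\<lambda>i. of_int (y i)) \<and>
    (\<forall>\<delta>. q_relation m q \<delta> \<longrightarrow> (\<exists>z\<in>solutions m (set L). pairing \<delta> z \<noteq> 0) \<longrightarrow>
       pairing \<delta> (\<lambda>i. of_int (y i)) \<noteq> 0) \<and>
    y (m - 1) \<le> prod_list (map mass L) * (\<Sum>j<k. int q ^ j)"
  using bal dim len x0
proof (induction k arbitrary: L x0)
  case 0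
  then show ?case by (intro zero_generic) (auto simp: dim_le_def)
next
  case (Suc k)
  show ?case
  proof (cases "\<forall>z\<in>solutions m (set L). z = (\<lambda>_. 0)")
    case True
    then show ?thesis by (intro zero_generic) auto
  next
    case False
    note x0 = Suc.prems(4)
    define S where "S = solutions m (set L)"
    define Q where "Q = {\<delta>. q_relation m q \<delta> \<and> (\<exists>z\<in>S. pairing \<delta> z \<noteq> 0)}"
    have Q: "finite Q"
      by (rule finite_subset[OF _ finite_q_relations[of m q]]) (auto simp: Q_def)
    have x0S: "x0 \<in> S" using x0 by (simp add: interior_point_def S_def)
    obtain i x1 where i: "Suc i < m" "0 < pairing (gap m i) x0"
      and x1: "interior_point m (insert (gap m i) (set L)) x1"
      using False ex_facet[OF x0] by blast
    define \<gamma> where "\<gamma> = gap m i"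
    have "\<exists>y :: nat \<Rightarrow> int. interior_point m (set (\<gamma> # L)) (\<lambda>i. of_int (y i)) \<and>
      (\<forall>\<delta>. q_relation m q \<delta> \<longrightarrow> (\<exists>z\<in>solutions m (set (\<gamma> # L)). pairing \<delta> z \<noteq> 0) \<longrightarrow>
         pairing \<delta> (\<lambda>i. of_int (y i)) \<noteq> 0) \<and>
      y (m - 1) \<le> prod_list (map mass (\<gamma> # L)) * (\<Sum>j<k. int q ^ j)"
    proof (rule Suc.IH)
      show "balanced m \<delta>" if "\<delta> \<in> set (\<gamma> # L)" for \<delta>
        using that Suc.prems(1) balanced_gap[OF i(1)] by (auto simp: \<gamma>_def)
      show "dim_le (solutions m (set (\<gamma> # L))) k"
        using dim_le_cut[OF Suc.prems(2), of x0 \<gamma>] x0S i(2) by (simp add: S_def \<gamma>_def)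
      show "length (\<gamma> # L) + k \<le> m - 1" using Suc.prems(3) by simp
      show "interior_point m (set (\<gamma> # L)) x1" using x1 by (simp add: \<gamma>_def)
    qed
    then obtain y' :: "nat \<Rightarrow> int"
      where y'int: "interior_point m (set (\<gamma> # L)) (\<lambda>i. of_int (y' i))"
      and y'gen: "\<And>\<delta> z. q_relation m q \<delta> \<Longrightarrow> pairing \<delta> (\<lambda>i. of_int (y' i)) = 0 \<Longrightarrow>
        z \<in> S \<Longrightarrow> pairing \<gamma> z = 0 \<Longrightarrow> pairing \<delta> z = 0"
      and y'bnd: "y' (m - 1) \<le> prod_list (map mass L) * (\<Sum>j<k. int q ^ j)"
      using mass_gap[OF i(1)] by (auto simp: solutions_insert S_def \<gamma>_def)
    define f where "f = (\<lambda>i. real_of_int (y' i))"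
    have fS: "f \<in> S" and f\<gamma>: "pairing \<gamma> f = 0"
      using y'int by (auto simp: interior_point_def solutions_insert S_def f_def)
    \<comment> \<open>By genericity of \<open>y'\<close>, a relation vanishing at \<open>f\<close>
      vanishes on the whole facet space, so on \<open>S\<close> it is a multiple of
      \<open>\<gamma>\<close>; \<open>x0\<close> determines the factor.\<close>
    have proportional: "pairing \<delta> z = pairing \<gamma> z / pairing \<gamma> x0 * pairing \<delta> x0"
      if "\<delta> \<in> Q" "pairing \<delta> f = 0" "z \<in> S" for \<delta> z
    proof -
      define c where "c = pairing \<gamma> z / pairing \<gamma> x0"
      have "(\<lambda>i. z i + (- c) * x0 i) \<in> S"
        using that(3) x0S unfolding S_def by (rule solutions_add_mult)
      moreover have "pairing \<gamma> (\<lambda>i. z i + (- c) * x0 i) = 0"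
        unfolding pairing_add_mult using i(2) by (simp add: c_def \<gamma>_def)
      ultimately have "pairing \<delta> (\<lambda>i. z i + (- c) * x0 i) = 0"
        using that y'gen[of \<delta>] by (simp add: Q_def f_def)
      then show ?thesis unfolding pairing_add_mult by (simp add: c_def)
    qed
    \<comment> \<open>The signs of \<open>s\<close> describe the chamber that contains \<open>f + \<epsilon> x0\<close> for small \<open>\<epsilon> > 0\<close>.\<close>
    define s where "s \<delta> = (if pairing \<delta> f \<noteq> 0 then pairing \<delta> f else pairing \<delta> x0)" for \<delta>
    have x0nz: "pairing \<delta> x0 \<noteq> 0" if \<delta>: "\<delta> \<in> Q" "pairing \<delta> f = 0" for \<delta>
    proof -
      obtain z where "z \<in> S" "pairing \<delta> z \<noteq> 0" using \<delta> by (auto simp: Q_def)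
      then show ?thesis using proportional[OF \<delta>, of z] by auto
    qed
    then have s0: "s \<delta> \<noteq> 0" if "\<delta> \<in> Q" for \<delta> using that by (simp add: s_def)
    define I where "I = {\<delta> \<in> Q. pairing \<delta> f \<noteq> 0}"
    have "\<exists>N>0. \<forall>\<delta>\<in>I. 0 < s \<delta> * pairing \<delta> x0 + N * (s \<delta> * pairing \<delta> f)"
    proof (rule ex_dominating_multiple)
      show "finite I" using Q by (simp add: I_def)
      show "0 < s \<delta> * pairing \<delta> f" if "\<delta> \<in> I" for \<delta>
        using that not_real_square_gt_zero[of "pairing \<delta> f"]
          by (simp add: I_def s_def del: not_real_square_gt_zero)
    qed
    then obtain N where N: "\<And>\<delta>. \<delta> \<in> I \<Longrightarrow> 0 < s \<delta> * pairing \<delta> x0 + N * (s \<delta> * pairing \<delta> f)"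
      by blast
    \<comment> \<open>Up to scaling this is \<open>f + \<epsilon> x0\<close> with
      \<open>\<epsilon>\<close> the inverse of \<open>N\<close>.\<close>
    define p0 where "p0 = (\<lambda>i. x0 i + N * f i)"
    have pp0: "pairing \<delta> p0 = pairing \<delta> x0 + N * pairing \<delta> f" for \<delta>
      unfolding p0_def by (rule pairing_add_mult)
    have "\<exists>p\<in>S. (\<forall>\<delta>\<in>Q. 0 \<le> s \<delta> * pairing \<delta> p) \<and> 0 < pairing \<gamma> p \<and>
      (\<forall>u\<in>S. (\<forall>\<delta>\<in>Q. pairing \<delta> p = 0 \<longrightarrow> pairing \<delta> u = 0) \<longrightarrow> (\<exists>c. u = (\<lambda>i. c * p i)))"
    proof (rule ex_chamber_ray[OF q, where m = m and R = "set L", folded S_def, folded Q_def])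
      show "p0 \<in> S" using x0S fS unfolding p0_def S_def by (rule solutions_add_mult)
      show "0 \<le> s \<delta> * pairing \<delta> p0" if "\<delta> \<in> Q" for \<delta>
      proof (cases "pairing \<delta> f = 0")
        case True
        then show ?thesis by (simp add: pp0 s_def)
      next
        case False
        then show ?thesis using N[of \<delta>] that by (simp add: pp0 I_def algebra_simps)
      qed
      show "0 < pairing \<gamma> p0" using i(2) by (simp add: pp0 f\<gamma>) (simp add: \<gamma>_def)
    qed (rule s0)
    then obtain p where pS: "p \<in> S" and p_nonneg: "\<forall>\<delta>\<in>Q. 0 \<le> s \<delta> * pairing \<delta> p"
      and p\<gamma>: "0 < pairing \<gamma> p"
      and p_line: "\<forall>u\<in>S. (\<forall>\<delta>\<in>Q. pairing \<delta> p = 0 \<longrightarrow> pairing \<delta> u = 0) \<longrightarrow> (\<exists>c. u = (\<lambda>i. c * p i))"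
      by (elim bexE conjE)
    note p_nn = bspec[OF p_nonneg]
    have gapQ: "gap m l \<in> Q" if "Suc l < m" "z \<in> S" "pairing (gap m l) z \<noteq> 0" for l z
      using that q by (auto simp: Q_def intro: q_relation_gap)
    have f_gap: "0 \<le> pairing (gap m l) f" if "Suc l < m" for l
      using y'int that fS f\<gamma> unfolding f_def[symmetric]
      by (auto simp: interior_point_def solutions_insert S_def less_imp_le)
    \<comment> \<open>A gap not identically zero on \<open>S\<close> is nonnegative at
      \<open>f\<close> and positive at \<open>x0\<close>, so its sign \<open>s\<close> is positive
      and the chamber lies in the cone.\<close>
    have p_gap: "0 \<le> pairing (gap m l) p" if l: "Suc l < m" for l
    proof (cases "pairing (gap m l) p = 0")
      case False
      then have lQ: "gap m l \<in> Q" using gapQ[OF l pS] by blast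
      then obtain z where "z \<in> S" "pairing (gap m l) z \<noteq> 0" by (auto simp: Q_def)
      then have "0 < pairing (gap m l) x0"
        using x0 l by (auto simp: interior_point_def S_def)
      then have "0 < s (gap m l)" using f_gap[OF l] by (auto simp: s_def)
      then show ?thesis using p_nn[OF lQ] by (simp add: zero_le_mult_iff)
    qed simp
    have p0: "p 0 = 0" using pS by (simp add: S_def solutions_def)
    have "p 0 \<le> p i" "p (Suc i) \<le> p (m - 1)"
      using i(1) by (auto intro: gaps_nonneg_mono p_gap)
    then have p_last: "0 < p (m - 1)"
      using p\<gamma> p0 i(1) by (simp add: \<gamma>_def pairing_gap)
    have "\<exists>M. set M \<subseteq> {\<delta> \<in> Q. pairing \<delta> p = 0} \<and> length M \<le> k \<and>
      (\<forall>u\<in>solutions m (set (M @ L)). \<exists>c. u = (\<lambda>i. c * p i))"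
    proof (rule ex_cutting_list)
      show "dim_le (solutions m (set L)) (Suc k)" by (rule Suc.prems)
      show "p \<in> solutions m (set L)" using pS by (simp add: S_def)
      show "p \<noteq> (\<lambda>_. 0)" using p_last by auto
    qed (use p_line in \<open>auto simp: S_def\<close>)
    then obtain M where M: "set M \<subseteq> {\<delta> \<in> Q. pairing \<delta> p = 0}" "length M \<le> k"
      and line: "\<And>u. u \<in> solutions m (set (M @ L)) \<Longrightarrow> \<exists>c. u = (\<lambda>i. c * p i)"
      by blast
    have "\<exists>y c. 0 < c \<and> (\<forall>i. real_of_int (y i) = c * p i) \<and> y (m - 1) \<le> prod_list (map mass (M @ L))"
    proof (rule ex_integer_ray[OF m _ _ line p_last])
      show "balanced m \<delta>" if "\<delta> \<in> set (M @ L)" for \<delta>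
        using that Suc.prems(1) M by (auto simp: Q_def q_relation_def)
      show "length (M @ L) \<le> m - 2" using M(2) Suc.prems(3) by simp
    qed
    then obtain z c where c: "0 < c" and z: "\<And>i. real_of_int (z i) = c * p i"
      and z_bnd: "z (m - 1) \<le> prod_list (map mass (M @ L))" by blast
    define y where "y i = y' i + z i" for i
    have yf: "(\<lambda>i. real_of_int (y i)) = (\<lambda>i. f i + c * p i)"
      by (simp add: y_def f_def z)
    have yS: "(\<lambda>i. real_of_int (y i)) \<in> S"
      unfolding yf using fS pS unfolding S_def by (rule solutions_add_mult)
    have py: "pairing \<delta> (\<lambda>i. real_of_int (y i)) = pairing \<delta> f + c * pairing \<delta> p" for \<delta>
      unfolding yf by (rule pairing_add_mult)
    \<comment> \<open>A relation vanishing at \<open>f\<close> is a nonzero multiple of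
      \<open>\<gamma>\<close>, which is positive at \<open>p\<close>. Otherwise its values at
      \<open>f\<close> and \<open>p\<close> are not of opposite signs and cannot cancel.\<close>
    have generic: "pairing \<delta> (\<lambda>i. real_of_int (y i)) \<noteq> 0" if \<delta>: "\<delta> \<in> Q" for \<delta>
    proof (cases "pairing \<delta> f = 0")
      case True
      have "pairing \<delta> p \<noteq> 0"
        using proportional[OF \<delta> True pS] x0nz[OF \<delta> True] p\<gamma> i(2) by (simp add: \<gamma>_def)
      then show ?thesis using True c by (simp add: py)
    next
      case False
      then have "0 < pairing \<delta> f * pairing \<delta> f"
        using not_real_square_gt_zero by blast
      moreover have "0 \<le> c * (pairing \<delta> f * pairing \<delta> p)"
        using p_nn[OF \<delta>] False c by (simp add: s_def)
      ultimately have "0 < pairing \<delta> f * (pairing \<delta> f + c * pairing \<delta> p)"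
        by (simp add: algebra_simps)
      then show ?thesis by (auto simp: py)
    qed
    have "interior_point m (set L) (\<lambda>i. real_of_int (y i))"
      unfolding interior_point_def S_def[symmetric]
    proof (intro conjI allI impI yS)
      fix l assume l: "Suc l < m"
      have "0 \<le> pairing (gap m l) (\<lambda>i. real_of_int (y i))"
        using f_gap[OF l] p_gap[OF l] c by (simp add: py)
      then show "(\<forall>z\<in>S. pairing (gap m l) z = 0) \<or> 0 < pairing (gap m l) (\<lambda>i. real_of_int (y i))"
        using generic[of "gap m l"] gapQ[OF l] by (auto simp: less_le)
    qed
    moreover have "y (m - 1) \<le> prod_list (map mass L) * (\<Sum>j<Suc k. int q ^ j)"
    proof -
      have "prod_list (map mass M) \<le> int q ^ k"
        using M q by (intro prod_list_mass_le) (auto simp: Q_def q_relation_def)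
      moreover have "0 \<le> prod_list (map mass L)"
        by (auto intro!: prod_list_nonneg simp: mass_nonneg)
      ultimately have "prod_list (map mass (M @ L)) \<le> int q ^ k * prod_list (map mass L)"
        by (simp add: mult_right_mono)
      then have "y (m - 1) \<le> prod_list (map mass L) * (\<Sum>j<k. int q ^ j) + int q ^ k * prod_list (map mass L)"
        using y'bnd z_bnd by (simp add: y_def)
      then show ?thesis by (simp add: algebra_simps)
    qed
    ultimately show ?thesis
      using generic by (intro exI[of _ y]) (auto simp: Q_def S_def)
  qed
qed

subsection \<open>Rational spans of deleted rows\<close>

text \<open>Expand \<open>v\<close> in \<open>S\<close> and exchange the sums. The lemma carries
  facts about rational rows over to real tuples.\<close>

lemma sum_of_rat_span_zero:
  fixes x :: "nat \<Rightarrow> real"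
  assumes S: "S \<subseteq> carrier_vec n"
    and v: "v \<in> LinearCombinations.module.span class_ring (module_vec TYPE(rat) n) S"
    and x: "\<And>w. w \<in> S \<Longrightarrow> (\<Sum>i<n. of_rat (w $ i) * x i) = 0"
  shows "(\<Sum>i<n. of_rat (v $ i) * x i) = 0"
proof -
  interpret vec_space "TYPE(rat)" n .
  obtain a A where A: "v = lincomb a A" "finite A" "A \<subseteq> S"
    using in_spanE[OF v] by blast
  have "(\<Sum>i<n. of_rat (v $ i) * x i) = (\<Sum>i<n. \<Sum>w\<in>A. of_rat (a w) * (of_rat (w $ i) * x i))"
    using A S by (intro sum.cong)
      (auto simp: lincomb_index of_rat_sum of_rat_mult sum_distrib_right mult.assoc)
  also have "\<dots> = (\<Sum>w\<in>A. of_rat (a w) * (\<Sum>i<n. of_rat (w $ i) * x i))"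
    unfolding sum_distrib_left by (rule sum.swap)
  also have "\<dots> = 0" using A x by (intro sum.neutral) auto
  finally show ?thesis .
qed

lemma pairing_deleted_row:
  assumes "\<delta> \<in> carrier_vec (Suc n)" and "x 0 = 0"
  shows "(\<Sum>i<n. of_rat (deleted_row \<delta> $ i) * x (Suc i)) = pairing \<delta> x"
  using assms by (simp add: pairing_Suc deleted_row_def)

text \<open>Steinitz exchange extends the independent rows to a spanning set by at most
  \<open>n\<close> minus their number of further vectors, which supply the functionals. A solution
  on which these vanish is orthogonal to all unit vectors.\<close>

lemma dim_le_solutions_lin_indpt:
  assumes R: "R \<subseteq> carrier_vec (Suc n)" and finB: "finite (deleted_row ` R)"
    and li: "\<not> LinearCombinations.module.lin_dep class_ring (module_vec TYPE(rat) n) (deleted_row ` R)"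
  shows "card (deleted_row ` R) \<le> n"
    and "dim_le (solutions (Suc n) R) (n - card (deleted_row ` R))"
proof -
  interpret vec_space "TYPE(rat)" n .
  define B where "B = deleted_row ` R"
  have B: "B \<subseteq> carrier_vec n" using R by (auto simp: B_def deleted_row_def)
  have "\<exists>C. finite C \<and> C \<subseteq> carrier_vec n \<and> C \<subseteq> span (set (unit_vecs n)) \<and> C \<inter> B = {} \<and>
      int (card C) \<le> int (card (set (unit_vecs n :: rat vec list))) - int (card B) \<and>
      span (B \<union> C) = span (set (unit_vecs n))"
    by (rule replacement) (use finB li B in \<open>auto simp: B_def span_unit_vecs_is_carrier unit_vecs_carrier\<close>)
  then obtain C where C: "finite C" "C \<subseteq> carrier_vec n" "int (card C) \<le> int n - int (card B)"
    and span: "span (B \<union> C) = carrier_vec n"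
    by (auto simp: span_unit_vecs_is_carrier distinct_card[OF unit_vecs_distinct])
  then show "card (deleted_row ` R) \<le> n" by (simp add: B_def)
  obtain cs where cs: "set cs = C" "distinct cs" using finite_distinct_list[OF C(1)] by blast
  then have len: "length cs \<le> n - card B" using C(3) distinct_card[OF cs(2)] by simp
  \<comment> \<open>The exchange bounds the number of added vectors only from above; surplus indices
    get the zero functional.\<close>
  define F where "F j x = (if j < length cs then \<Sum>i<n. of_rat (cs ! j $ i) * x (Suc i) else 0)"
    for j and x :: "nat \<Rightarrow> real"
  show "dim_le (solutions (Suc n) R) (n - card (deleted_row ` R))"
    unfolding dim_le_def B_def[symmetric]
  proof (intro exI[of _ F] conjI allI ballI impI)
    fix j x y t
    show "F j (\<lambda>i. x i + t * y i) = F j x + t * F j y"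
      by (simp add: F_def sum.distrib sum_distrib_left algebra_simps)
  next
    fix x assume x: "x \<in> solutions (Suc n) R" and F0: "\<forall>j<n - card B. F j x = 0"
    have gen: "(\<Sum>i<n. of_rat (w $ i) * x (Suc i)) = 0" if w: "w \<in> B \<union> C" for w
    proof (cases "w \<in> B")
      case True
      then obtain \<delta> where "\<delta> \<in> R" "w = deleted_row \<delta>" by (auto simp: B_def)
      then show ?thesis using x R by (auto simp: solutions_def pairing_deleted_row)
    next
      case False
      then obtain j where "j < length cs" "w = cs ! j"
        using w cs(1) by (auto simp: in_set_conv_nth)
      then show ?thesis using F0[rule_format, of j] len by (simp add: F_def)
    qed
    have unit: "x (Suc j) = 0" if j: "j < n" for j
    proof -
      have "(\<Sum>i<n. of_rat (unit_vec n j $ i) * x (Suc i)) = 0"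
      proof (rule sum_of_rat_span_zero[where S = "B \<union> C"])
        show "B \<union> C \<subseteq> carrier_vec n" using B C by auto
        show "unit_vec n j \<in> span (B \<union> C)" unfolding span by simp
      qed (rule gen)
      moreover have "(\<Sum>i<n. of_rat (unit_vec n j $ i) * x (Suc i)) = (\<Sum>i<n. if i = j then x (Suc i) else 0)"
        using j by (intro sum.cong) auto
      ultimately show ?thesis using j by simp
    qed
    show "x = (\<lambda>_. 0)"
    proof
      fix i
      show "x i = 0"
        using x unit[of "i - 1"] by (cases "i = 0 \<or> Suc n \<le> i") (auto simp: solutions_def)
    qed
  qed
qed

text \<open>Span and linear dependence inside the subspace agree with those of the ambient space,
  where the remaining arguments take place.\<close>

lemma relation_space_basis:
  assumes basis: "vectorspace.basis class_ring (relation_space m q T) B" and finB: "finite B"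
  shows "vectorspace.dim class_ring (relation_space m q T) = card B"
    and "\<not> LinearCombinations.module.lin_dep class_ring (module_vec TYPE(rat) (m - 1)) B"
    and "\<And>\<delta>. q_relation m q \<delta> \<Longrightarrow> vanishes_on \<delta> T \<Longrightarrow>
      deleted_row \<delta> \<in> LinearCombinations.module.span class_ring (module_vec TYPE(rat) (m - 1)) B"
proof -
  define n where "n = m - 1"
  interpret vec_space "TYPE(rat)" n .
  define D where "D = deleted_row ` {\<delta>. q_relation m q \<delta> \<and> vanishes_on \<delta> T}"
  have D: "D \<subseteq> carrier_vec n"
    by (auto simp: D_def q_relation_def balanced_def deleted_row_def n_def)
  have rs: "relation_space m q T = vs (span D)"
    by (simp add: relation_space_def D_def n_def)
  have sub: "subspace class_ring (span D) V" using D by (intro span_is_subspace) simp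
  interpret W: vectorspace class_ring "vs (span D)" by (rule subspace_is_vs[OF sub])
  have b: "W.basis B" using basis by (simp add: rs)
  show "vectorspace.dim class_ring (relation_space m q T) = card B"
    unfolding rs using finB b by (rule W.dim_basis)
  have BD: "B \<subseteq> span D" using b by (auto simp: W.basis_def)
  have "submodule class_ring (span D) V" using sub by (simp add: subspace_def)
  note dep = span_li_not_depend[OF BD this]
  show "\<not> LinearCombinations.module.lin_dep class_ring (module_vec TYPE(rat) (m - 1)) B"
    using b dep(2) unfolding n_def[symmetric] by (simp add: W.basis_def)
  have "span B = span D" using b dep(1) by (simp add: W.basis_def)
  moreover have "deleted_row \<delta> \<in> span D" if "q_relation m q \<delta>" "vanishes_on \<delta> T" for \<delta>
    using that in_own_span[of D] D by (auto simp: D_def)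
  ultimately show "deleted_row \<delta> \<in> LinearCombinations.module.span class_ring (module_vec TYPE(rat) (m - 1)) B"
    if "q_relation m q \<delta>" "vanishes_on \<delta> T" for \<delta>
    using that unfolding n_def[symmetric] by simp
qed

section \<open>Translation, scaling and the final model\<close>

text \<open>A translation by \<open>c\<close> changes the value by \<open>c\<close> times the sum of
  a balanced vector, which is \<open>0\<close>.\<close>

lemma vanishes_on_iff_pairing:
  fixes T :: "real vec"
  assumes "balanced m \<delta>" and "T \<in> carrier_vec m" and "\<And>i. i < m \<Longrightarrow> x i = T $ i - c"
  shows "vanishes_on \<delta> T \<longleftrightarrow> pairing \<delta> x = 0"
proof -
  have d: "dim_vec \<delta> = m" using assms(1) by (auto simp: balanced_def)
  have "pairing \<delta> x = (\<Sum>i<m. of_int (\<delta> $ i) * T $ i - c * of_int (\<delta> $ i))"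
    unfolding pairing_def d by (intro sum.cong) (simp_all add: assms(3) right_diff_distrib mult.commute)
  also have "\<dots> = (\<Sum>i<m. of_int (\<delta> $ i) * T $ i) - c * of_int (\<Sum>i<m. \<delta> $ i)"
    by (simp add: sum_subtractf sum_distrib_left)
  also have "\<dots> = map_vec of_int \<delta> \<bullet> T"
    using assms(1,2) d by (auto simp: balanced_def scalar_prod_def atLeast0LessThan intro!: sum.cong)
  finally show ?thesis by (simp add: vanishes_on_def)
qed

lemma vanishes_on_vec_iff_pairing:
  assumes "balanced m \<delta>" and "g \<noteq> 0"
  shows "vanishes_on \<delta> (vec m y) \<longleftrightarrow> pairing \<delta> (\<lambda>i. of_int (g * y i)) = 0"
proof -
  have d: "dim_vec \<delta> = m" using assms(1) by (auto simp: balanced_def)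
  have "pairing \<delta> (\<lambda>i. of_int (g * y i)) = of_int (\<Sum>i<m. g * (\<delta> $ i * y i))"
    by (simp add: pairing_def d algebra_simps)
  also have "(\<Sum>i<m. g * (\<delta> $ i * y i)) = g * (\<Sum>i<m. \<delta> $ i * y i)"
    by (simp only: sum_distrib_left)
  finally have "pairing \<delta> (\<lambda>i. of_int (g * y i)) = 0 \<longleftrightarrow> g * (\<Sum>i<m. \<delta> $ i * y i) = 0"
    by (simp only: of_int_eq_0_iff)
  moreover have "map_vec of_int \<delta> \<bullet> vec m y = (\<Sum>i<m. \<delta> $ i * y i)"
    using d by (auto simp: scalar_prod_def atLeast0LessThan intro!: sum.cong)
  ultimately show ?thesis using assms(2) by (simp add: vanishes_on_def)
qed

lemma Gcd_div_Gcd: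
  fixes f :: "'b \<Rightarrow> int"
  assumes "Gcd (f ` A) \<noteq> 0"
  shows "Gcd ((\<lambda>i. f i div Gcd (f ` A)) ` A) = 1"
proof -
  define g where "g = Gcd (f ` A)"
  define h where "h i = f i div g" for i
  have "f i = g * h i" if "i \<in> A" for i
    using that by (simp add: h_def g_def)
  then have "f ` A = (*) g ` h ` A" by (auto simp: image_image intro!: image_cong)
  then have "g = normalize (g * Gcd (h ` A))"
    unfolding Gcd_mult[symmetric] by (simp add: g_def)
  then have "\<bar>g\<bar> * 1 = \<bar>g\<bar> * Gcd (h ` A)"
    by (simp add: g_def)
  then show ?thesis using assms unfolding mult_cancel_left by (simp add: g_def h_def)
qed

theorem theorem3p2:
  fixes m q r d :: nat and T :: "real vec" and V :: "(rat, rat vec) module"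
    and \<delta> :: "nat \<Rightarrow> int vec" and h :: "nat \<Rightarrow> int" and H :: int
  assumes "m \<ge> 2" and "q \<ge> 2"
    and "increasing_tuple m T"
    and "V = relation_space m q T"
    and "r = vectorspace.dim class_ring V"
    and "d = m - 1 - r"
    and "\<forall>i<r. q_relation m q (\<delta> i) \<and> vanishes_on (\<delta> i) T"
    and "vectorspace.basis class_ring V ((\<lambda>i. deleted_row (\<delta> i)) ` {..<r})"
    and "\<forall>i<r. h i = mass (\<delta> i)"
    and "H = (\<Prod>i<r. h i)"
  shows "\<exists>T'. integer_q_model m q T T' \<and> primitive T' \<and>
           diameter T' \<le> H * (\<Sum>j<d. int q ^ j)"
proof -
  define n where "n = m - 1"
  have mn: "m = Suc n" and n: "0 < n" using assms(1) by (auto simp: n_def)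
  define L where "L = map \<delta> [0..<r]"
  define S where "S = solutions m (set L)"
  have setL: "set L = \<delta> ` {..<r}" by (auto simp: L_def)
  have bal: "balanced m \<alpha>" if "\<alpha> \<in> set L" for \<alpha>
    using that assms(7) by (auto simp: setL q_relation_def)
  have T: "T \<in> carrier_vec m" and T_less: "\<And>i j. i < j \<Longrightarrow> j < m \<Longrightarrow> T $ i < T $ j"
    using assms(3) by (auto simp: increasing_tuple_def)
  define B where "B = deleted_row ` set L"
  have B: "vectorspace.basis class_ring (relation_space m q T) B"
    using assms(4,8) by (simp add: B_def setL image_image)
  have finB: "finite B" by (simp add: B_def)
  note basis = relation_space_basis[OF B finB]
  have card: "card B = r" using basis(1) assms(4,5) by simp
  have Lc: "set L \<subseteq> carrier_vec (Suc n)" using bal by (auto simp: balanced_def mn)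
  have li: "\<not> LinearCombinations.module.lin_dep class_ring (module_vec TYPE(rat) n) (deleted_row ` set L)"
    using basis(2) by (simp add: n_def B_def)
  \<comment> \<open>The inequality makes the natural-number subtraction in \<open>d\<close> exact,
    so that \<open>r + d\<close> equals \<open>m - 1\<close>.\<close>
  have r: "r \<le> n" and dim: "dim_le S d"
    using dim_le_solutions_lin_indpt[OF Lc _ li] finB card
    by (simp_all add: S_def mn B_def[symmetric] assms(6))
  define x0 where "x0 i = (if i < m then T $ i - T $ 0 else 0)" for i
  have van: "vanishes_on \<alpha> T \<longleftrightarrow> pairing \<alpha> x0 = 0" if "balanced m \<alpha>" for \<alpha>
    by (rule vanishes_on_iff_pairing[OF that T]) (simp add: x0_def)
  have x0S: "x0 \<in> S"
    using assms(7) van by (auto simp: S_def solutions_def setL x0_def q_relation_def)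
  have x0_gap: "0 < pairing (gap m i) x0" if "Suc i < m" for i
    using that T_less[of i "Suc i"] by (simp add: pairing_gap x0_def)
  have x0_int: "interior_point m (set L) x0"
    using x0S x0_gap by (auto simp: interior_point_def S_def)
  obtain y :: "nat \<Rightarrow> int" where y_int: "interior_point m (set L) (\<lambda>i. of_int (y i))"
    and y_gen: "\<And>\<alpha>. q_relation m q \<alpha> \<Longrightarrow> \<exists>z\<in>S. pairing \<alpha> z \<noteq> 0 \<Longrightarrow> pairing \<alpha> (\<lambda>i. of_int (y i)) \<noteq> 0"
    and y_bnd: "y (m - 1) \<le> prod_list (map mass L) * (\<Sum>j<d. int q ^ j)"
    using ex_generic_integer_point[OF assms(1) _ bal dim[unfolded S_def] _ x0_int, of q] assms(2,6) r
    by (auto simp: S_def L_def mn)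
  have yS: "(\<lambda>i. real_of_int (y i)) \<in> S" using y_int by (simp add: interior_point_def S_def)
  have y0: "y 0 = 0" using yS by (simp add: S_def solutions_def)
  \<comment> \<open>\<open>x0\<close> shows that no gap vanishes identically on \<open>S\<close>, so
    relative interior points are strictly increasing.\<close>
  have y_gap: "0 < pairing (gap m i) (\<lambda>i. real_of_int (y i))" if "Suc i < m" for i
    using y_int x0_gap[OF that] x0S that by (force simp: interior_point_def S_def)
  have y_less: "y i < y j" if "i < j" "j < m" for i j
  proof -
    have "real_of_int (y i) < real_of_int (y (Suc i))"
      using y_gap[of i] that by (simp add: pairing_gap)
    also have "\<dots> \<le> real_of_int (y j)"
      using that y_gap by (intro gaps_nonneg_mono[of m "\<lambda>i. real_of_int (y i)"]) (auto intro: less_imp_le)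
    finally show ?thesis by simp
  qed
  \<comment> \<open>Forward, the deleted row of \<open>\<alpha>\<close> is in the span of the basis,
    which annihilates \<open>y\<close>. Backward, a relation vanishing at the generic
    \<open>y\<close> vanishes on all of \<open>S\<close>, in particular at
    \<open>x0\<close>.\<close>
  have y_van: "vanishes_on \<alpha> T \<longleftrightarrow> pairing \<alpha> (\<lambda>i. real_of_int (y i)) = 0" if \<alpha>: "q_relation m q \<alpha>" for \<alpha>
  proof
    assume "vanishes_on \<alpha> T"
    have \<alpha>c: "\<alpha> \<in> carrier_vec (Suc n)" using \<alpha> by (auto simp: q_relation_def balanced_def mn)
    have "(\<Sum>i<n. of_rat (deleted_row \<alpha> $ i) * real_of_int (y (Suc i))) = 0"
    proof (rule sum_of_rat_span_zero)
      show "B \<subseteq> carrier_vec n" using Lc by (auto simp: B_def deleted_row_def)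
      show "deleted_row \<alpha> \<in> LinearCombinations.module.span class_ring (module_vec TYPE(rat) n) B"
        using basis(3)[OF \<alpha> \<open>vanishes_on \<alpha> T\<close>] by (simp add: n_def)
    next
      fix w assume "w \<in> B"
      then obtain \<beta> where \<beta>: "\<beta> \<in> set L" "w = deleted_row \<beta>" by (auto simp: B_def)
      then have "pairing \<beta> (\<lambda>i. real_of_int (y i)) = 0" using yS by (simp add: S_def solutions_def)
      then show "(\<Sum>i<n. of_rat (w $ i) * real_of_int (y (Suc i))) = 0"
        using pairing_deleted_row[of \<beta> n "\<lambda>i. real_of_int (y i)"] \<beta> Lc y0 by auto
    qed
    then show "pairing \<alpha> (\<lambda>i. real_of_int (y i)) = 0"
      using pairing_deleted_row[OF \<alpha>c, of "\<lambda>i. real_of_int (y i)"] y0 by simp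
  next
    assume "pairing \<alpha> (\<lambda>i. real_of_int (y i)) = 0"
    then have "pairing \<alpha> x0 = 0" using y_gen[OF \<alpha>] x0S by blast
    then show "vanishes_on \<alpha> T" using van \<alpha> by (simp add: q_relation_def)
  qed
  \<comment> \<open>Dividing by the gcd gives primitivity; it preserves order and relations and, as
    \<open>g\<close> is at least \<open>1\<close>, does not enlarge the diameter.\<close>
  define g where "g = Gcd (y ` {..<m})"
  define t where "t i = y i div g" for i
  have "y 0 < y n" using y_less[of 0 n] n mn by simp
  have "y n \<in> y ` {..<m}" by (simp add: mn)
  then have "g \<noteq> 0" using \<open>y 0 < y n\<close> y0 by (auto simp: g_def Gcd_0_iff)
  moreover have "0 \<le> g" by (simp add: g_def)
  ultimately have g: "0 < g" by simp
  have gt: "y i = g * t i" if "i < m" for i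
    using that by (simp add: t_def g_def)
  have t0: "t 0 = 0" by (simp add: t_def y0)
  define T' where "T' = vec m t"
  have "increasing_tuple m T'"
    unfolding increasing_tuple_def
  proof (intro conjI allI impI)
    fix i j assume ij: "i < j \<and> j < m"
    then have "g * t i < g * t j" using y_less[of i j] gt[of i] gt[of j] by simp
    then show "T' $ i < T' $ j" using ij g by (simp add: T'_def)
  qed (simp add: T'_def)
  moreover have "vanishes_on \<alpha> T \<longleftrightarrow> vanishes_on \<alpha> T'" if \<alpha>: "q_relation m q \<alpha>" for \<alpha>
  proof -
    have b: "balanced m \<alpha>" using \<alpha> by (simp add: q_relation_def)
    then have "pairing \<alpha> (\<lambda>i. real_of_int (g * t i)) = pairing \<alpha> (\<lambda>i. real_of_int (y i))"
      unfolding pairing_def by (intro sum.cong) (auto simp: gt balanced_def)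
    then show ?thesis
      using y_van[OF \<alpha>] vanishes_on_vec_iff_pairing[OF b \<open>g \<noteq> 0\<close>, of t] by (simp add: T'_def)
  qed
  ultimately have "integer_q_model m q T T'" by (simp add: integer_q_model_def)
  moreover have "primitive T'"
  proof -
    have "(\<lambda>i. T' $ i - T' $ 0) ` {..<dim_vec T'} = t ` {..<m}"
      using mn t0 by (auto simp: T'_def intro!: image_cong)
    then show ?thesis
      using Gcd_div_Gcd[of y "{..<m}"] \<open>g \<noteq> 0\<close> by (simp add: primitive_def t_def[abs_def] g_def)
  qed
  moreover have "diameter T' \<le> H * (\<Sum>j<d. int q ^ j)"
  proof -
    have "diameter T' = t n" using t0 by (simp add: diameter_def T'_def mn)
    moreover have "y n = g * t n" using gt[of n] by (simp add: mn)
    moreover have "0 < t n" using \<open>y n = g * t n\<close> \<open>y 0 < y n\<close> y0 g by (simp add: zero_less_mult_iff)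
    ultimately have "diameter T' \<le> y (m - 1)" using g mult_right_mono[of 1 g "t n"] by (simp add: n_def)
    moreover have "prod_list (map mass L) = H"
      using assms(9,10) by (simp add: L_def prod.list_conv_set_nth atLeast0LessThan)
    ultimately show ?thesis using y_bnd by simp
  qed
  ultimately show ?thesis by blast
qed

end
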